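(* Let $\theta=\begin{bmatrix}\alpha&\gamma\\ \beta&\delta\end{bmatrix}\in GL_2(\mathbb{Z})$ and $G=(\mathbb{Z}\oplus\mathbb{Z})\rtimes_\theta\mathbb{Z}$. Let $p$ be an odd prime. The cohomology groups $H^*(G,\mathbb{Z}_p)$, where $\mathbb{Z}_p$ is the trivial $\mathbb{Z}G$-module, are given by $$H^0(G,\mathbb{Z}_p)\cong\mathbb{Z}_p,\qquad H^1(G,\mathbb{Z}_p)\cong(\mathbb{Z}_p)^{3-\mathrm{rank}_{\mathbb{Z}_p}(\theta-I)},$$ $$H^2(G,\mathbb{Z}_p)\cong\begin{cases}(\mathbb{Z}_p)^{3-\mathrm{rank}_{\mathbb{Z}_p}(\theta-I)},&\text{if }\det\theta=1,\\(\mathbb{Z}_p)^{2-\mathrm{rank}_{\mathbb{Z}_p}(\theta-I)},&\text{if }\det\theta=-1,\end{cases}$$ $$H^3(G,\mathbb{Z}_p)\cong\begin{cases}\mathbb{Z}_p,&\text{if }\det\theta=1,\\0,&\text{if }\det\theta=-1,\end{cases}\qquad H^n(G,\mathbb{Z}_p)\cong0\text{ if }n\ge4.$$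
   Context: Write $\mathbb{Z}\oplus\mathbb{Z}=\langle a,b\mid ab=ba\rangle$ and $\mathbb{Z}=\langle t\rangle$; $t$ acts on $\mathbb{Z}\oplus\mathbb{Z}$ by $a\mapsto a^\alpha b^\beta$, $b\mapsto a^\gamma b^\delta$ (this automorphism is also denoted $\theta$). $G=(\mathbb{Z}\oplus\mathbb{Z})\rtimes_\theta\mathbb{Z}=\{(a^mb^n,t^k):m,n,k\in\mathbb{Z}\}$ with product $(g,t^k)(h,t^l)=(g\,\theta^k(h),t^{k+l})$; it is the fundamental group of the torus bundle over $S^1$ determined by $\theta$. $\mathbb{Z}_p=\mathbb{Z}/p\mathbb{Z}$, $I$ is the $2\times2$ identity matrix, and $\mathrm{rank}_{\mathbb{Z}_p}(\theta-I)$ is the rank over the field $\mathbb{Z}_p$ of the reduction of $\theta-I$ mod $p$. *)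

theory Defs
  imports
    "HOL-Analysis.Analysis"
    "HOL-Algebra.Product_Groups"
    "HOL-Algebra.Bij"
    "HOL-Number_Theory.Residues"
    "Jordan_Normal_Form.Missing_VectorSpace"
begin

definition semidirect_product ::
    "('a, 'm) monoid_scheme \<Rightarrow> ('b, 'n) monoid_scheme \<Rightarrow> ('b \<Rightarrow> 'a \<Rightarrow> 'a) \<Rightarrow> ('a \<times> 'b) monoid"
  where "semidirect_product N H \<phi> =
    \<lparr>carrier = carrier N \<times> carrier H,
     monoid.mult = (\<lambda>(g, k) (h, l). (g \<otimes>\<^bsub>N\<^esub> \<phi> k h, k \<otimes>\<^bsub>H\<^esub> l)),
     one = (\<one>\<^bsub>N\<^esub>, \<one>\<^bsub>H\<^esub>)\<rparr>"

text \<open>The free abelian group on a, b, written additively: the column vector with entries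
  m, n stands for a^m b^n.\<close>

definition int_plane :: "(int ^ 2) monoid"
  where "int_plane = \<lparr>carrier = UNIV, monoid.mult = (+), one = 0\<rparr>"

text \<open>The pair (v, k) stands for (a^m b^n, t^k). The columns of \<open>\<theta>\<close> are the images
  of a and b, so t acts by \<open>v \<mapsto> \<theta> *v v\<close>, and t^k by the k-th (possibly negative) power of
  this map in the automorphism group. This is meaningful only for \<open>\<theta>\<close> invertible over
  the integers.\<close>

definition torus_bundle_group :: "int ^ 2 ^ 2 \<Rightarrow> ((int ^ 2) \<times> int) monoid"
  where "torus_bundle_group \<theta> =
    semidirect_product int_plane integer_group (\<lambda>k. ((*v) \<theta>) [^]\<^bsub>AutoGroup int_plane\<^esub> k)"

text \<open>Cohomology of a group G with coefficients in a G-module, computed from the inhomogeneous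
  cochains of the (unnormalised) bar resolution. The underlying abelian group M of the module is
  an HOL-Algebra group, hence written multiplicatively, and \<open>act g\<close> is the action of g on M.
  An n-tuple of group elements is a list of length n.\<close>

definition group_tuples :: "('a, 'm) monoid_scheme \<Rightarrow> nat \<Rightarrow> 'a list set"
  where "group_tuples G n = {xs. length xs = n \<and> set xs \<subseteq> carrier G}"

definition cochain_group ::
    "('a, 'm) monoid_scheme \<Rightarrow> ('b, 'n) monoid_scheme \<Rightarrow> nat \<Rightarrow> ('a list \<Rightarrow> 'b) monoid"
  where "cochain_group G M n = product_group (group_tuples G n) (\<lambda>_. M)"

definition merge_at :: "('a, 'm) monoid_scheme \<Rightarrow> nat \<Rightarrow> 'a list \<Rightarrow> 'a list"
  where "merge_at G i xs = take i xs @ (xs ! i \<otimes>\<^bsub>G\<^esub> xs ! Suc i) # drop (i + 2) xs"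

text \<open>Additively,
  \[ (df)(g_1,\ldots,g_{n+1}) = g_1 f(g_2,\ldots,g_{n+1})
     + \sum_{i=1}^{n} (-1)^i f(g_1,\ldots,g_i g_{i+1},\ldots,g_{n+1})
     + (-1)^{n+1} f(g_1,\ldots,g_n); \]
  below the summation index starts at 0.\<close>

definition coboundary_map ::
    "('a, 'm) monoid_scheme \<Rightarrow> ('b, 'n) monoid_scheme \<Rightarrow> ('a \<Rightarrow> 'b \<Rightarrow> 'b) \<Rightarrow> nat
      \<Rightarrow> ('a list \<Rightarrow> 'b) \<Rightarrow> ('a list \<Rightarrow> 'b)"
  where "coboundary_map G M act n f =
    (\<lambda>xs\<in>group_tuples G (Suc n).
       act (hd xs) (f (tl xs))
       \<otimes>\<^bsub>M\<^esub> (\<Otimes>\<^bsub>M\<^esub>i\<in>{..<n}. f (merge_at G i xs) [^]\<^bsub>M\<^esub> ((- 1) ^ Suc i :: int))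
       \<otimes>\<^bsub>M\<^esub> f (butlast xs) [^]\<^bsub>M\<^esub> ((- 1) ^ Suc n :: int))"

definition cocycles ::
    "('a, 'm) monoid_scheme \<Rightarrow> ('b, 'n) monoid_scheme \<Rightarrow> ('a \<Rightarrow> 'b \<Rightarrow> 'b) \<Rightarrow> nat
      \<Rightarrow> ('a list \<Rightarrow> 'b) set"
  where "cocycles G M act n =
    kernel (cochain_group G M n) (cochain_group G M (Suc n)) (coboundary_map G M act n)"

definition coboundaries ::
    "('a, 'm) monoid_scheme \<Rightarrow> ('b, 'n) monoid_scheme \<Rightarrow> ('a \<Rightarrow> 'b \<Rightarrow> 'b) \<Rightarrow> nat
      \<Rightarrow> ('a list \<Rightarrow> 'b) set"
  where "coboundaries G M act n =
    (case n of
       0 \<Rightarrow> {\<one>\<^bsub>cochain_group G M 0\<^esub>}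
     | Suc k \<Rightarrow> coboundary_map G M act k ` carrier (cochain_group G M k))"

definition group_cohomology ::
    "('a, 'm) monoid_scheme \<Rightarrow> ('b, 'n) monoid_scheme \<Rightarrow> ('a \<Rightarrow> 'b \<Rightarrow> 'b) \<Rightarrow> nat
      \<Rightarrow> ('a list \<Rightarrow> 'b) set monoid"
  where "group_cohomology G M act n =
    (cochain_group G M n)\<lparr>carrier := cocycles G M act n\<rparr> Mod coboundaries G M act n"

definition trivial_coeff_cohomology ::
    "('a, 'm) monoid_scheme \<Rightarrow> ('b, 'n) monoid_scheme \<Rightarrow> nat \<Rightarrow> ('a list \<Rightarrow> 'b) set monoid"
  where "trivial_coeff_cohomology G M = group_cohomology G M (\<lambda>_ m. m)"

definition Zp_power :: "nat \<Rightarrow> nat \<Rightarrow> (nat \<Rightarrow> int) monoid"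
  where "Zp_power p d = product_group {..<d} (\<lambda>_. integer_mod_group p)"

text \<open>The rank over the field \<open>residue_ring p\<close> (for p prime) of the reduction mod p of an
  integer matrix: the dimension of the span of the reduced columns.\<close>

definition column_mod :: "nat \<Rightarrow> int ^ 'n ^ 'm \<Rightarrow> 'n \<Rightarrow> 'm \<Rightarrow> int"
  where "column_mod p A j = (\<lambda>i. A $ i $ j mod int p)"

definition rank_mod :: "nat \<Rightarrow> int ^ 'n ^ 'm \<Rightarrow> nat"
  where "rank_mod p A =
    (let K = residue_ring (int p); V = ring.func_space K (UNIV :: 'm set)
     in vectorspace.dim K
          (V\<lparr>carrier := LinearCombinations.module.span K V (range (column_mod p A))\<rparr>))"

end

theory Submission
  imports Defs "HOL-Library.Function_Algebras"
begin

text \<open>Cohomology of \<open>G\<close> is computed from homogeneous cochains: functions on tuples of elements of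
  \<open>G\<close> that are invariant under left multiplication. Without any invariance the complex is
  acyclic. Imposing invariance along the chain of subgroups \<open>1 < <a> < <a, b> < G\<close> one generator
  \<open>s\<close> at a time replaces a complex \<open>E\<close> by the kernel of \<open>s - 1\<close>. This map is onto, because \<open>s\<close>
  generates a free action of the integers on the orbits, so each step has a long exact sequence,
  and all orders follow from those of the kernels of \<open>s - 1\<close> on cohomology. The generators \<open>a\<close>
  and \<open>b\<close> act trivially. To see how \<open>t\<close> acts on the cohomology of \<open><a, b>\<close>, explicit cocycles in
  degrees 1 and 2 are detected by evaluating on the edges and the boundary of the unit square;
  \<open>t\<close> acts by the transpose of \<open>\<theta>\<close> and by \<open>det \<theta>\<close>. Finally, a finite abelian group of prime
  exponent is determined by its order.\<close>

section \<open>Additive subgroups and their indices\<close>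

text \<open>Orders suffice because every cohomology group is abelian of exponent \<open>p\<close>,
  so no extension problem in the exact sequences has to be solved. Each intermediate complex
  consists of cochains on tuples of all of \<open>G\<close>, with invariance only under the subgroup
  reached so far. The subgroup acts freely on \<open>G\<close>, so this still computes its
  cohomology, and \<open>t\<close> acts directly on the complex that computes the cohomology of <a,
  b>. The order of the chain matters: each generator must normalize the subgroup before it. The
  obstacle is the action of \<open>t\<close> in degrees 1 and 2, which orders alone do not
  determine. Yet knowing the orders beforehand helps: explicit cocycles that attain enough values
  must exhaust the classes, so no primitives have to be built. Oddness of \<open>p\<close> enters
  when det \<theta> = -1, where t - 1 is multiplication by -2 in degree 2. Cochains take values in a
  fixed type of class \<open>ab_group_add\<close> while \<open>p\<close> varies; hence the
  coefficients are realized as (1/p)Z/Z inside Q/Z.\<close>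

definition add_subgroup :: "'a::ab_group_add set \<Rightarrow> bool"
  where "add_subgroup S \<longleftrightarrow> 0 \<in> S \<and> (\<forall>x\<in>S. \<forall>y\<in>S. x - y \<in> S)"

lemma add_subgroupI:
  assumes "0 \<in> S" "\<And>x y. x \<in> S \<Longrightarrow> y \<in> S \<Longrightarrow> x - y \<in> S"
  shows "add_subgroup S"
  using assms by (auto simp: add_subgroup_def)

lemma add_subgroup_zero: "add_subgroup S \<Longrightarrow> 0 \<in> S"
  by (simp add: add_subgroup_def)

lemma add_subgroup_diff: "add_subgroup S \<Longrightarrow> x \<in> S \<Longrightarrow> y \<in> S \<Longrightarrow> x - y \<in> S"
  by (simp add: add_subgroup_def)

lemma add_subgroup_uminus: "add_subgroup S \<Longrightarrow> x \<in> S \<Longrightarrow> - x \<in> S"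
  by (metis add_subgroup_def diff_0)

lemma add_subgroup_add: "add_subgroup S \<Longrightarrow> x \<in> S \<Longrightarrow> y \<in> S \<Longrightarrow> x + y \<in> S"
  by (metis add_subgroup_diff add_subgroup_uminus diff_minus_eq_add)

definition add_coset :: "'a::ab_group_add set \<Rightarrow> 'a \<Rightarrow> 'a set"
  where "add_coset B x = {y. y - x \<in> B}"

text \<open>An infinite index counts as 0; this is why finiteness of a cohomology group appears
  below as a nonzero order.\<close>

definition add_index :: "'a::ab_group_add set \<Rightarrow> 'a set \<Rightarrow> nat"
  where "add_index A B = card (add_coset B ` A)"

lemma add_coset_eq_iff:
  assumes "add_subgroup B"
  shows "add_coset B x = add_coset B y \<longleftrightarrow> x - y \<in> B"
proof
  assume "add_coset B x = add_coset B y"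
  moreover have "x \<in> add_coset B x"
    by (simp add: add_coset_def add_subgroup_zero[OF assms])
  ultimately show "x - y \<in> B"
    by (simp add: add_coset_def)
next
  assume *: "x - y \<in> B"
  have "z - x \<in> B \<longleftrightarrow> z - y \<in> B" for z
    using add_subgroup_add[OF assms, of "z - x", OF _ *] add_subgroup_diff[OF assms, of "z - y", OF _ *]
    by (auto simp: algebra_simps)
  then show "add_coset B x = add_coset B y"
    by (simp add: add_coset_def)
qed

lemma card_image_eq_if_same_kernel:
  assumes "(g \<circ> h) ` A = g ` B"
    and "\<And>x y. x \<in> A \<Longrightarrow> y \<in> A \<Longrightarrow> f x = f y \<longleftrightarrow> g (h x) = g (h y)"
  shows "card (f ` A) = card (g ` B)"
proof -
  define \<psi> where "\<psi> = (\<lambda>X. g (h (inv_into A f X)))"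
  have \<psi>: "\<psi> (f x) = g (h x)" if "x \<in> A" for x
    using assms(2)[of "inv_into A f (f x)" x] that
    by (simp add: \<psi>_def f_inv_into_f inv_into_into)
  have "inj_on \<psi> (f ` A)"
    using assms(2) by (auto simp: inj_on_def \<psi>)
  moreover have "\<psi> ` f ` A = g ` B"
    using assms(1) by (auto simp: image_image \<psi>)
  ultimately show ?thesis
    by (metis card_image)
qed

text \<open>The isomorphism theorem for quotients, with \<phi> only onto modulo \<open>R\<close>.
  The terms of the exact sequences below are compared through it.\<close>

lemma add_index_vimage:
  assumes "\<phi> ` P \<subseteq> Q" "\<And>q. q \<in> Q \<Longrightarrow> \<exists>x\<in>P. q - \<phi> x \<in> R"
    and "add_subgroup P" "add_subgroup R"
    and "\<And>x y. x \<in> P \<Longrightarrow> y \<in> P \<Longrightarrow> \<phi> (x - y) = \<phi> x - \<phi> y"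
  shows "add_index Q R = add_index P {x \<in> P. \<phi> x \<in> R}"
proof -
  have zero: "\<phi> 0 = 0"
    using assms(5)[of 0 0] assms(3) by (simp add: add_subgroup_def)
  have sub: "add_subgroup {x \<in> P. \<phi> x \<in> R}"
    using assms(3-5) by (auto simp: add_subgroup_def zero)
  have "add_coset R q \<in> (add_coset R \<circ> \<phi>) ` P" if q: "q \<in> Q" for q
  proof -
    obtain x where "x \<in> P" "q - \<phi> x \<in> R"
      using assms(2)[OF q] by blast
    then show ?thesis
      by (metis add_coset_eq_iff[OF assms(4)] comp_apply imageI)
  qed
  then have "(add_coset R \<circ> \<phi>) ` P = add_coset R ` Q"
    using assms(1) by auto
  moreover have "add_coset {x \<in> P. \<phi> x \<in> R} x = add_coset {x \<in> P. \<phi> x \<in> R} y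
      \<longleftrightarrow> add_coset R (\<phi> x) = add_coset R (\<phi> y)" if "x \<in> P" "y \<in> P" for x y
    using that assms by (simp add: add_coset_eq_iff[OF sub] add_coset_eq_iff add_subgroup_diff)
  ultimately show ?thesis
    unfolding add_index_def
    using card_image_eq_if_same_kernel[of "add_coset R" \<phi> P Q "add_coset {x \<in> P. \<phi> x \<in> R}"] by simp
qed

text \<open>Representatives of A/B and of B/C add up to representatives of A/C. This is a bijection
  of coset sets, so the equation also holds, as 0 = 0, for infinite indices.\<close>

lemma add_index_tower:
  assumes "add_subgroup A" "add_subgroup B" "add_subgroup C" "C \<subseteq> B" "B \<subseteq> A"
  shows "add_index A C = add_index A B * add_index B C"
proof -
  define r where "r = inv_into A (add_coset B)"
  have r: "r X \<in> A" "add_coset B (r X) = X" if "X \<in> add_coset B ` A" for X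
    using that by (auto simp: r_def inv_into_into f_inv_into_f)
  define s where "s = inv_into B (add_coset C)"
  have s: "s X \<in> B" "add_coset C (s X) = X" if "X \<in> add_coset C ` B" for X
    using that by (auto simp: s_def inv_into_into f_inv_into_f)
  define f where "f = (\<lambda>(X, Y). add_coset C (r X + s Y))"
  have "inj_on f (add_coset B ` A \<times> add_coset C ` B)"
  proof (rule inj_onI, clarify)
    fix x y x' y'
    assume xy: "x \<in> A" "y \<in> B" "x' \<in> A" "y' \<in> B"
      and eq: "f (add_coset B x, add_coset C y) = f (add_coset B x', add_coset C y')"
    define X Y X' Y' where "X = add_coset B x" "Y = add_coset C y" "X' = add_coset B x'" "Y' = add_coset C y'"
    have mem: "X \<in> add_coset B ` A" "Y \<in> add_coset C ` B" "X' \<in> add_coset B ` A" "Y' \<in> add_coset C ` B"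
      using xy by (auto simp: X_Y_X'_Y'_def)
    have *: "(r X + s Y) - (r X' + s Y') \<in> C"
      using eq by (simp add: f_def X_Y_X'_Y'_def add_coset_eq_iff[OF assms(3)])
    have "s Y' - s Y \<in> B"
      using s mem assms(2) by (auto intro: add_subgroup_diff)
    with * have "((r X + s Y) - (r X' + s Y')) + (s Y' - s Y) \<in> B"
      using assms by (blast intro: add_subgroup_add)
    then have "r X - r X' \<in> B"
      by (simp add: algebra_simps)
    then have "X = X'"
      using r(2)[OF mem(1)] r(2)[OF mem(3)] add_coset_eq_iff[OF assms(2), of "r X" "r X'"] by simp
    with * have "s Y - s Y' \<in> C"
      by simp
    then have "Y = Y'"
      using s(2)[OF mem(2)] s(2)[OF mem(4)] add_coset_eq_iff[OF assms(3), of "s Y" "s Y'"] by simp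
    with \<open>X = X'\<close> show "add_coset B x = add_coset B x' \<and> add_coset C y = add_coset C y'"
      by (simp add: X_Y_X'_Y'_def)
  qed
  moreover have "f ` (add_coset B ` A \<times> add_coset C ` B) = add_coset C ` A"
  proof
    show "f ` (add_coset B ` A \<times> add_coset C ` B) \<subseteq> add_coset C ` A"
    proof (clarify)
      fix x y assume "x \<in> A" "y \<in> B"
      then have "r (add_coset B x) \<in> A" "s (add_coset C y) \<in> B"
        using r s by auto
      then show "f (add_coset B x, add_coset C y) \<in> add_coset C ` A"
        using assms by (auto simp: f_def intro!: imageI add_subgroup_add)
    qed
    show "add_coset C ` A \<subseteq> f ` (add_coset B ` A \<times> add_coset C ` B)"
    proof (clarify)
      fix x assume x: "x \<in> A"
      define b where "b = x - r (add_coset B x)"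
      have b: "b \<in> B"
        using r(2)[of "add_coset B x"] x add_coset_eq_iff[OF assms(2), of x "r (add_coset B x)"]
        by (simp add: b_def)
      have "s (add_coset C b) - b \<in> C"
        using s(2)[of "add_coset C b"] b add_coset_eq_iff[OF assms(3), of "s (add_coset C b)" b] by simp
      then have "(r (add_coset B x) + s (add_coset C b)) - x \<in> C"
        by (simp add: b_def algebra_simps)
      then have "f (add_coset B x, add_coset C b) = add_coset C x"
        by (simp add: f_def add_coset_eq_iff[OF assms(3)])
      from this[symmetric] x b show "add_coset C x \<in> f ` (add_coset B ` A \<times> add_coset C ` B)"
        by (intro image_eqI[where x = "(add_coset B x, add_coset C b)"]) auto
    qed
  qed
  ultimately show ?thesis
    unfolding add_index_def using card_image[of f "add_coset B ` A \<times> add_coset C ` B"]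
    by (simp add: card_cartesian_product)
qed

lemma add_index_self:
  assumes "add_subgroup A"
  shows "add_index A A = 1"
proof -
  have "add_coset A x = add_coset A 0" if "x \<in> A" for x
    using that by (simp add: add_coset_eq_iff[OF assms])
  then have "add_coset A ` A = {add_coset A 0}"
    using add_subgroup_zero[OF assms] by blast
  then show ?thesis
    by (simp add: add_index_def)
qed

lemma add_index_one_imp_subset:
  assumes "add_subgroup A" "add_subgroup B" "add_index A B = 1"
  shows "A \<subseteq> B"
proof
  fix x assume "x \<in> A"
  moreover have "0 \<in> A"
    using assms(1) by (rule add_subgroup_zero)
  ultimately have "add_coset B x = add_coset B 0"
    using assms(3) unfolding add_index_def by (metis card_1_singletonE imageI singletonD)
  then show "x \<in> B"
    by (simp add: add_coset_eq_iff[OF assms(2)])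
qed

lemma add_index_zero: "add_index A {0} = card A"
proof -
  have "inj_on (add_coset {0}) A"
    using add_coset_eq_iff[of "{0}"] by (auto simp: inj_on_def add_subgroup_def)
  then show ?thesis
    by (simp add: add_index_def card_image)
qed

section \<open>Complexes of abelian groups\<close>

definition cx_cocycles :: "('a \<Rightarrow> 'a) \<Rightarrow> (nat \<Rightarrow> 'a::ab_group_add set) \<Rightarrow> nat \<Rightarrow> 'a set"
  where "cx_cocycles d E n = {x \<in> E n. d x = 0}"

definition cx_coboundaries :: "('a \<Rightarrow> 'a) \<Rightarrow> (nat \<Rightarrow> 'a::ab_group_add set) \<Rightarrow> nat \<Rightarrow> 'a set"
  where "cx_coboundaries d E n = (case n of 0 \<Rightarrow> {0} | Suc m \<Rightarrow> d ` E m)"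

definition cohom_order :: "('a \<Rightarrow> 'a) \<Rightarrow> (nat \<Rightarrow> 'a::ab_group_add set) \<Rightarrow> nat \<Rightarrow> nat"
  where "cohom_order d E n = add_index (cx_cocycles d E n) (cx_coboundaries d E n)"

locale add_complex =
  fixes E :: "nat \<Rightarrow> 'a::ab_group_add set" and d :: "'a \<Rightarrow> 'a"
  assumes E_subgroup: "add_subgroup (E n)"
    and d_diff: "d (x - y) = d x - d y"
    and d_in: "x \<in> E n \<Longrightarrow> d x \<in> E (Suc n)"
    and d_d: "x \<in> E n \<Longrightarrow> d (d x) = 0"
begin

abbreviation Z where "Z n \<equiv> cx_cocycles d E n"
abbreviation B where "B n \<equiv> cx_coboundaries d E n"

lemma d_zero: "d 0 = 0"
  using d_diff[of 0 0] by simp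

lemma Z_subgroup: "add_subgroup (Z n)"
  using E_subgroup[of n] by (auto simp: cx_cocycles_def add_subgroup_def d_diff d_zero)

lemma B_subgroup: "add_subgroup (B n)"
proof (cases n)
  case (Suc m)
  have "d x - d y \<in> d ` E m" if "x \<in> E m" "y \<in> E m" for x y
    using that imageI[of "x - y" "E m" d] by (simp add: d_diff add_subgroup_diff[OF E_subgroup])
  moreover have "0 \<in> d ` E m"
    using imageI[OF add_subgroup_zero[OF E_subgroup[of m]], of d] by (simp add: d_zero)
  ultimately show ?thesis
    by (auto simp: Suc cx_coboundaries_def add_subgroup_def)
qed (simp add: cx_coboundaries_def add_subgroup_def)

lemma B_subset_Z: "B n \<subseteq> Z n"
  using add_subgroup_zero[OF E_subgroup] d_in d_d
  by (cases n) (auto simp: cx_coboundaries_def cx_cocycles_def d_zero)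

end

text \<open>The long exact sequence of 0 -> ker D -> E -> E -> 0, reduced to the orders of its terms.
  Kernel and cokernel of the map that D induces on a finite cohomology group have the same order,
  so it suffices to know the kernels, which are represented by \<open>Fix\<close>.\<close>

locale add_complex_endo = add_complex +
  fixes D :: "'a \<Rightarrow> 'a"
  assumes D_diff: "D (x - y) = D x - D y"
    and D_onto: "D ` E n = E n"
    and d_D: "d (D x) = D (d x)"
begin

definition Fix where "Fix n = {z \<in> Z n. D z \<in> B n}"

lemma D_zero: "D 0 = 0"
  using D_diff[of 0 0] by simp

lemma D_in: "x \<in> E n \<Longrightarrow> D x \<in> E n"
  using D_onto by blast

lemma D_in_Z: "x \<in> Z n \<Longrightarrow> D x \<in> Z n"
  by (simp add: cx_cocycles_def D_in d_D D_zero)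

lemma D_in_B: "x \<in> B n \<Longrightarrow> D x \<in> B n"
  by (cases n) (auto simp: cx_coboundaries_def D_in D_zero simp flip: d_D)

lemma Fix_subgroup: "add_subgroup (Fix n)"
  using Z_subgroup[of n] B_subgroup[of n] by (auto simp: Fix_def add_subgroup_def D_diff D_zero)

lemma B_subset_Fix: "B n \<subseteq> Fix n"
  using B_subset_Z D_in_B by (auto simp: Fix_def)

lemma kernel_complex: "add_complex (\<lambda>n. {x \<in> E n. D x = 0}) d"
proof
  show "add_subgroup {x \<in> E n. D x = 0}" for n
    using E_subgroup[of n] by (auto simp: add_subgroup_def D_diff D_zero)
  show "d x \<in> {x \<in> E (Suc n). D x = 0}" if "x \<in> {x \<in> E n. D x = 0}" for x n
    using that d_in d_D[of x] by (simp add: d_zero)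
qed (auto simp: d_diff d_d)

text \<open>This set is the preimage in \<open>Z n\<close> of the image of D on cohomology, so its
  index in \<open>Z n\<close> is the order of the cokernel.\<close>

lemma cokernel_subgroup: "add_subgroup {z \<in> Z n. \<exists>w\<in>Z n. z - D w \<in> B n}"
  (is "add_subgroup ?C")
proof (rule add_subgroupI)
  show "0 \<in> ?C"
    using add_subgroup_zero[OF Z_subgroup[of n]] add_subgroup_zero[OF B_subgroup[of n]]
    by (intro CollectI conjI bexI[of _ 0]) (simp_all add: D_zero)
next
  fix x y assume "x \<in> ?C" "y \<in> ?C"
  then obtain v w where *: "x \<in> Z n" "y \<in> Z n" "v \<in> Z n" "x - D v \<in> B n" "w \<in> Z n" "y - D w \<in> B n"
    by auto
  then have "(x - D v) - (y - D w) \<in> B n"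
    using add_subgroup_diff[OF B_subgroup] by blast
  also have "(x - D v) - (y - D w) = (x - y) - D (v - w)"
    by (simp add: D_diff)
  finally show "x - y \<in> ?C"
    using add_subgroup_diff[OF Z_subgroup *(1,2)] add_subgroup_diff[OF Z_subgroup *(3,5)] by blast
qed

text \<open>For an endomorphism of a finite group H, |ker| |im| = |H| = |im| |coker|. The nonzero
  order is what allows |im| to be cancelled.\<close>

lemma card_cokernel:
  assumes "cohom_order d E n \<noteq> 0"
  shows "add_index (Z n) {z \<in> Z n. \<exists>w\<in>Z n. z - D w \<in> B n} = add_index (Fix n) (B n)"
proof -
  define C where "C = {z \<in> Z n. \<exists>w\<in>Z n. z - D w \<in> B n}"
  have C: "add_subgroup C"
    unfolding C_def by (rule cokernel_subgroup)
  have BC: "B n \<subseteq> C"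
    using B_subset_Z[of n] add_subgroup_zero[OF Z_subgroup[of n]] unfolding C_def
    by (intro subsetI CollectI conjI bexI[of _ 0]) (auto simp: D_zero)
  have "add_index C (B n) = add_index (Z n) {z \<in> Z n. D z \<in> B n}"
  proof (rule add_index_vimage)
    show "D ` Z n \<subseteq> C"
    proof (clarify)
      fix z assume z: "z \<in> Z n"
      have "D z - D z \<in> B n"
        using add_subgroup_zero[OF B_subgroup] by simp
      then show "D z \<in> C"
        using z by (auto simp only: C_def D_in_Z)
    qed
  qed (auto simp: C_def D_diff Z_subgroup B_subgroup)
  then have "add_index C (B n) = add_index (Z n) (Fix n)"
    by (simp add: Fix_def)
  moreover have "add_index (Z n) (B n) = add_index (Z n) (Fix n) * add_index (Fix n) (B n)"
    by (intro add_index_tower Z_subgroup Fix_subgroup B_subgroup B_subset_Fix) (auto simp: Fix_def)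
  moreover have "add_index (Z n) (B n) = add_index (Z n) C * add_index C (B n)"
    by (intro add_index_tower Z_subgroup C B_subgroup BC) (auto simp: C_def)
  ultimately have "add_index (Z n) C = add_index (Fix n) (B n)"
    using assms by (auto simp: cohom_order_def)
  then show ?thesis
    by (simp add: C_def)
qed

text \<open>The long exact sequence yields 0 -> coker(D on H^n) -> H^{n+1}(ker D) -> ker(D on
  H^{n+1}) -> 0. The middle group is filtered by the cocycles of ker D that become coboundaries in
  E; \<open>card_cokernel\<close> then replaces the cokernel by a kernel.\<close>

lemma cohom_order_kernel_Suc:
  assumes "cohom_order d E n \<noteq> 0"
  shows "cohom_order d (\<lambda>n. {x \<in> E n. D x = 0}) (Suc n)
    = add_index (Fix (Suc n)) (B (Suc n)) * add_index (Fix n) (B n)"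
proof -
  interpret K: add_complex "\<lambda>n. {x \<in> E n. D x = 0}" d
    by (rule kernel_complex)
  \<comment> \<open>\<open>P\<close> stands in for the connecting homomorphism: D maps it onto the
    cocycles of degree \<open>n\<close>, d maps it onto the cocycles of ker D that bound in E, and
    fact 4 says that the two relevant preimages in \<open>P\<close> agree.\<close>
  define P where "P = {g \<in> E n. d (D g) = 0}"
  define C where "C = {z \<in> Z n. \<exists>w\<in>Z n. z - D w \<in> B n}"
  have P: "add_subgroup P"
    using E_subgroup[of n] by (auto simp: P_def add_subgroup_def D_diff d_diff D_zero d_zero)
  have BS: "B (Suc n) = d ` E n" "K.B (Suc n) = d ` {x \<in> E n. D x = 0}"
    by (simp_all add: cx_coboundaries_def)
  have KZ: "K.Z m = {x \<in> Z m. D x = 0}" for m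
    by (auto simp: cx_cocycles_def)
  have 1: "add_index (Fix (Suc n)) (B (Suc n)) = add_index (K.Z (Suc n)) {x \<in> K.Z (Suc n). x \<in> B (Suc n)}"
  proof (rule add_index_vimage)
    show "(\<lambda>x. x) ` K.Z (Suc n) \<subseteq> Fix (Suc n)"
      using add_subgroup_zero[OF B_subgroup] by (auto simp: KZ Fix_def)
  next
    fix q assume "q \<in> Fix (Suc n)"
    then obtain h where h: "h \<in> E n" "q \<in> Z (Suc n)" "D q = d h"
      by (auto simp: Fix_def BS)
    \<comment> \<open>Surjectivity of D turns the defect \<open>D q = d h\<close> into a correction:
      \<open>q - d h'\<close> is killed by D and represents the same class.\<close>
    obtain h' where h': "h' \<in> E n" "h = D h'"
      using h D_onto by blast
    have "q - d h' \<in> K.Z (Suc n)"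
      using h h' d_in[OF h'(1)] d_d[OF h'(1)] add_subgroup_diff[OF E_subgroup, of q "Suc n" "d h'"]
      by (simp add: KZ cx_cocycles_def D_diff d_diff d_D flip: d_D)
    moreover have "q - (q - d h') \<in> B (Suc n)"
      using h' by (simp add: BS)
    ultimately show "\<exists>x\<in>K.Z (Suc n). q - x \<in> B (Suc n)"
      by blast
  qed (auto simp: K.Z_subgroup B_subgroup)
  have 2: "add_index {x \<in> K.Z (Suc n). x \<in> B (Suc n)} (K.B (Suc n)) = add_index P {g \<in> P. d g \<in> K.B (Suc n)}"
  proof (rule add_index_vimage)
    show "d ` P \<subseteq> {x \<in> K.Z (Suc n). x \<in> B (Suc n)}"
      using d_in d_d by (auto simp: P_def BS KZ cx_cocycles_def d_D)
  next
    fix q assume "q \<in> {x \<in> K.Z (Suc n). x \<in> B (Suc n)}"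
    then obtain g where "g \<in> E n" "q = d g" "D q = 0"
      by (auto simp: BS KZ)
    then have "g \<in> P" "q - d g \<in> K.B (Suc n)"
      using add_subgroup_zero[OF K.B_subgroup] by (auto simp: P_def d_D)
    then show "\<exists>x\<in>P. q - d x \<in> K.B (Suc n)"
      by blast
  qed (auto simp: P K.B_subgroup d_diff)
  have C: "add_subgroup C"
    unfolding C_def by (rule cokernel_subgroup)
  have 3: "add_index (Z n) C = add_index P {g \<in> P. D g \<in> C}"
  proof (rule add_index_vimage)
    show "D ` P \<subseteq> Z n"
      by (auto simp: P_def cx_cocycles_def D_in)
  next
    fix q assume q: "q \<in> Z n"
    then obtain g where "g \<in> E n" "q = D g"
      using D_onto by (auto simp: cx_cocycles_def)
    with q have "g \<in> P" "q - D g \<in> C"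
      using add_subgroup_zero[OF C] by (auto simp: P_def cx_cocycles_def)
    then show "\<exists>x\<in>P. q - D x \<in> C"
      by blast
  qed (auto simp: P C D_diff)
  have 4: "{g \<in> P. d g \<in> K.B (Suc n)} = {g \<in> P. D g \<in> C}"
  proof (intro Collect_cong conj_cong refl iffI)
    fix g assume g: "g \<in> P" "d g \<in> K.B (Suc n)"
    then obtain h where h: "h \<in> E n" "D h = 0" "d g = d h"
      by (auto simp: BS)
    have "g - h \<in> Z n"
      using h g add_subgroup_diff[OF E_subgroup] by (auto simp: cx_cocycles_def P_def d_diff)
    moreover have "D g - D (g - h) \<in> B n"
      using h add_subgroup_zero[OF B_subgroup] by (simp add: D_diff)
    ultimately show "D g \<in> C"
      using g by (auto simp: C_def P_def cx_cocycles_def D_in)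
  next
    fix g assume g: "g \<in> P" "D g \<in> C"
    then obtain w where w: "w \<in> Z n" "D g - D w \<in> B n"
      by (auto simp: C_def)
    \<comment> \<open>A coboundary of degree \<open>n\<close> lifts along D to a cocycle by lifting
      its primitive; in degree 0 the only coboundary is 0.\<close>
    have "\<exists>u\<in>E n. d u = 0 \<and> D u = D g - D w"
    proof (cases n)
      case 0
      with w add_subgroup_zero[OF E_subgroup[of 0]] show ?thesis
        by (intro bexI[of _ 0]) (auto simp: cx_coboundaries_def d_zero D_zero)
    next
      case (Suc m)
      then obtain h where "h \<in> E m" "d h = D g - D w"
        using w by (auto simp: cx_coboundaries_def)
      moreover then obtain h' where "h' \<in> E m" "h = D h'"
        using D_onto by blast
      ultimately show ?thesis
        using d_in d_d by (auto simp: Suc d_D intro!: bexI[of _ "d h'"])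
    qed
    then obtain u where u: "u \<in> E n" "d u = 0" "D u = D g - D w"
      by blast
    have "d (g - w - u) = d g" "g - w - u \<in> {x \<in> E n. D x = 0}"
      using u w g add_subgroup_diff[OF E_subgroup] by (auto simp: cx_cocycles_def P_def d_diff D_diff)
    then show "d g \<in> K.B (Suc n)"
      unfolding BS by (metis imageI)
  qed
  have "cohom_order d (\<lambda>n. {x \<in> E n. D x = 0}) (Suc n)
      = add_index (K.Z (Suc n)) {x \<in> K.Z (Suc n). x \<in> B (Suc n)}
        * add_index {x \<in> K.Z (Suc n). x \<in> B (Suc n)} (K.B (Suc n))"
    unfolding cohom_order_def
  proof (rule add_index_tower)
    show "add_subgroup {x \<in> K.Z (Suc n). x \<in> B (Suc n)}"
      using K.Z_subgroup B_subgroup unfolding add_subgroup_def by blast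
    show "K.B (Suc n) \<subseteq> {x \<in> K.Z (Suc n). x \<in> B (Suc n)}"
      using K.B_subset_Z[of "Suc n"] by (auto simp: BS)
  qed (auto simp: K.Z_subgroup K.B_subgroup)
  with 1 2 3 4 card_cokernel[OF assms] show ?thesis
    unfolding C_def by (simp only:)
qed

lemma Fix_eq_B_if_trivial:
  assumes "cohom_order d E n = 1"
  shows "Fix n = B n"
  using add_index_one_imp_subset[OF Z_subgroup B_subgroup] assms B_subset_Fix
  by (fastforce simp: cohom_order_def Fix_def)

end

section \<open>Homogeneous cochains and free flows\<close>

text \<open>The alternating sum over all deletions of one entry. Splitting off the head, with the
  tail deletions carrying the opposite sign, makes naturality and d d = 0 inductions on the
  list.\<close>

fun simplicial_diff :: "('x list \<Rightarrow> 'a::ab_group_add) \<Rightarrow> 'x list \<Rightarrow> 'a" where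
  "simplicial_diff f [] = 0"
| "simplicial_diff f (x # xs) = f xs - simplicial_diff (\<lambda>ys. f (x # ys)) xs"

lemma simplicial_diff_minus:
  "simplicial_diff (\<lambda>ys. f ys - g ys) xs = simplicial_diff f xs - simplicial_diff g xs"
  by (induction xs arbitrary: f g) simp_all

lemma simplicial_diff_diff: "simplicial_diff (f - g) = simplicial_diff f - simplicial_diff g"
  using simplicial_diff_minus[of f g] by (simp add: fun_eq_iff fun_diff_def)

lemma simplicial_diff_simplicial_diff: "simplicial_diff (simplicial_diff f) xs = 0"
proof (induction xs arbitrary: f)
  case (Cons x xs)
  then show ?case
    using simplicial_diff_minus[of f "simplicial_diff (\<lambda>ys. f (x # ys))" xs] by simp
qed simp

lemma simplicial_diff_map: "simplicial_diff (\<lambda>ys. f (map k ys)) xs = simplicial_diff f (map k xs)"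
proof (induction xs arbitrary: f)
  case (Cons x xs)
  then show ?case
    using Cons[of "\<lambda>ys. f (k x # ys)"] by simp
qed simp

lemma simplicial_diff_eq_0:
  assumes "\<And>ys. Suc (length ys) = length xs \<Longrightarrow> f ys = 0"
  shows "simplicial_diff f xs = 0"
  using assms by (induction xs arbitrary: f) simp_all

lemma simplicial_diff_in:
  assumes "add_subgroup A" "\<And>ys. f ys \<in> A"
  shows "simplicial_diff f xs \<in> A"
  using assms(2)
  by (induction xs arbitrary: f) (simp_all add: add_subgroup_zero[OF assms(1)] add_subgroup_diff[OF assms(1)])

text \<open>Degree \<open>n\<close> means tuples of length n + 1. Vanishing on all other lengths
  lets all degrees share one type.\<close>

definition cochains :: "'a::ab_group_add set \<Rightarrow> ('x \<Rightarrow> 'x) set \<Rightarrow> nat \<Rightarrow> ('x list \<Rightarrow> 'a) set"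
  where "cochains A K n = {f. (\<forall>xs. f xs \<in> A) \<and> (\<forall>xs. length xs \<noteq> Suc n \<longrightarrow> f xs = 0)
    \<and> (\<forall>k\<in>K. \<forall>xs. f (map k xs) = f xs)}"

lemma cochainsI:
  assumes "\<And>xs. f xs \<in> A" "\<And>xs. length xs \<noteq> Suc n \<Longrightarrow> f xs = 0"
    "\<And>k xs. k \<in> K \<Longrightarrow> f (map k xs) = f xs"
  shows "f \<in> cochains A K n"
  using assms by (simp add: cochains_def)

lemma cochainsD:
  assumes "f \<in> cochains A K n"
  shows "f xs \<in> A" "length xs \<noteq> Suc n \<Longrightarrow> f xs = 0" "k \<in> K \<Longrightarrow> f (map k xs) = f xs"
  using assms by (simp_all add: cochains_def)

lemma add_complex_cochains:
  assumes "add_subgroup A"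
  shows "add_complex (cochains A K) simplicial_diff"
proof
  show "add_subgroup (cochains A K n)" for n
    by (rule add_subgroupI)
      (auto simp: cochains_def add_subgroup_zero[OF assms] add_subgroup_diff[OF assms])
  show "simplicial_diff f \<in> cochains A K (Suc n)" if f: "f \<in> cochains A K n" for f n
  proof (rule cochainsI)
    show "simplicial_diff f xs \<in> A" for xs
      using simplicial_diff_in[OF assms] cochainsD(1)[OF f] by blast
    show "simplicial_diff f xs = 0" if "length xs \<noteq> Suc (Suc n)" for xs
      using that by (intro simplicial_diff_eq_0 cochainsD(2)[OF f]) auto
    show "simplicial_diff f (map k xs) = simplicial_diff f xs" if "k \<in> K" for k xs
      using cochainsD(3)[OF f that] by (simp flip: simplicial_diff_map)
  qed
  show "simplicial_diff (simplicial_diff f) = 0" for f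
    by (simp add: fun_eq_iff simplicial_diff_simplicial_diff)
qed (rule simplicial_diff_diff)

lemma cocycles_0_iff:
  "f \<in> cx_cocycles simplicial_diff (cochains A K) 0
    \<longleftrightarrow> f \<in> cochains A K 0 \<and> (\<forall>x y. f [x] = f [y])"
proof -
  have "simplicial_diff f = 0 \<longleftrightarrow> (\<forall>x y. f [x] = f [y])" if f: "f \<in> cochains A K 0"
  proof
    assume *: "simplicial_diff f = 0"
    have "f [y] = f [x]" for x y
      using fun_cong[OF *, of "[x, y]"] by simp
    then show "\<forall>x y. f [x] = f [y]"
      by blast
  next
    assume *: "\<forall>x y. f [x] = f [y]"
    show "simplicial_diff f = 0"
    proof
      fix xs :: "'a list"
      show "simplicial_diff f xs = 0 xs"
      proof (cases "length xs = 2")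
        case True
        then obtain x y where "xs = [x, y]"
          by (auto simp: length_Suc_conv numeral_2_eq_2)
        then show ?thesis
          using *[rule_format, of x y] by simp
      next
        case False
        then show ?thesis
          using cochainsD(2)[OF f] by (simp add: simplicial_diff_eq_0)
      qed
    qed
  qed
  then show ?thesis
    by (auto simp: cx_cocycles_def)
qed

lemma cocycle_1_iff:
  assumes "f \<in> cochains A K 1"
  shows "f \<in> cx_cocycles simplicial_diff (cochains A K) 1 \<longleftrightarrow> (\<forall>x y z. f [x, z] = f [x, y] + f [y, z])"
proof -
  have "simplicial_diff f = 0 \<longleftrightarrow> (\<forall>x y z. simplicial_diff f [x, y, z] = 0)"
  proof
    assume *: "\<forall>x y z. simplicial_diff f [x, y, z] = 0"
    show "simplicial_diff f = 0"
    proof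
      fix xs :: "'a list"
      show "simplicial_diff f xs = 0 xs"
      proof (cases "length xs = 3")
        case True
        then obtain x y z where "xs = [x, y, z]"
          by (auto simp: length_Suc_conv numeral_3_eq_3)
        then show ?thesis
          using * by simp
      next
        case False
        then show ?thesis
          using cochainsD(2)[OF assms] by (simp add: simplicial_diff_eq_0)
      qed
    qed
  qed simp
  also have "\<dots> \<longleftrightarrow> (\<forall>x y z. f [x, z] = f [x, y] + f [y, z])"
    by (auto simp: algebra_simps)
  finally show ?thesis
    using assms by (simp add: cx_cocycles_def)
qed

text \<open>Degree-0 cocycles are the constant functions, whatever \<open>K\<close> is, so
  evaluation at an arbitrary point identifies them with \<open>A\<close>.\<close>

lemma cohom_order_cochains_0:
  assumes "add_subgroup A"
  shows "cohom_order simplicial_diff (cochains A (K :: ('x \<Rightarrow> 'x) set)) 0 = card A"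
proof -
  let ?Z = "cx_cocycles simplicial_diff (cochains A K) 0"
  define x :: 'x where "x = undefined"
  have "bij_betw (\<lambda>f. f [x]) ?Z A"
    unfolding bij_betw_def
  proof
    show "inj_on (\<lambda>f. f [x]) ?Z"
    proof (rule inj_onI)
      fix f g assume fg: "f \<in> ?Z" "g \<in> ?Z" "f [x] = g [x]"
      show "f = g"
      proof
        fix xs
        show "f xs = g xs"
        proof (cases "length xs = 1")
          case True
          then obtain y where "xs = [y]"
            by (auto simp: length_Suc_conv)
          moreover have "f [y] = f [x]" "g [y] = g [x]"
            using fg(1,2) unfolding cocycles_0_iff by blast+
          ultimately show ?thesis
            using fg(3) by simp
        next
          case False
          then show ?thesis
            using fg(1,2) by (simp add: cocycles_0_iff cochains_def)
        qed
      qed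
    qed
    show "(\<lambda>f. f [x]) ` ?Z = A"
    proof (intro equalityI subsetI)
      fix a assume a: "a \<in> A"
      then have "(\<lambda>xs. if length xs = 1 then a else 0) \<in> ?Z"
        using add_subgroup_zero[OF assms] by (simp add: cocycles_0_iff cochains_def)
      from imageI[OF this, of "\<lambda>f. f [x]"] show "a \<in> (\<lambda>f. f [x]) ` ?Z"
        by simp
    qed (auto simp: cocycles_0_iff cochains_def)
  qed
  then have "card ?Z = card A"
    by (rule bij_betw_same_card)
  then show ?thesis
    by (simp add: cohom_order_def cx_coboundaries_def add_index_zero)
qed

text \<open>The cone over a fixed point \<open>e\<close>: reading df = 0 on \<open>e # xs\<close>
  gives f = dg with g(ys) = f(e # ys). Such a \<open>g\<close> need not inherit any invariance,
  hence the empty \<open>K\<close>.\<close>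

lemma cohom_order_cochains_no_invariance:
  assumes "add_subgroup A"
  shows "cohom_order simplicial_diff (cochains A ({} :: ('x \<Rightarrow> 'x) set)) (Suc n) = 1"
proof -
  interpret add_complex "cochains A ({} :: ('x \<Rightarrow> 'x) set)" simplicial_diff
    by (rule add_complex_cochains[OF assms])
  define e :: 'x where "e = undefined"
  have "f \<in> B (Suc n)" if f: "f \<in> Z (Suc n)" for f
  proof -
    define g where "g = (\<lambda>ys. f (e # ys))"
    have fc: "f \<in> cochains A {} (Suc n)" "simplicial_diff f = 0"
      using f by (auto simp: cx_cocycles_def)
    have "g \<in> cochains A {} n"
      by (rule cochainsI) (auto simp: g_def cochainsD[OF fc(1)])
    moreover have "f = simplicial_diff g"
    proof
      show "f xs = simplicial_diff g xs" for xs
        using fun_cong[OF fc(2), of "e # xs"] by (simp add: g_def)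
    qed
    ultimately show ?thesis
      by (simp add: cx_coboundaries_def)
  qed
  then have "Z (Suc n) = B (Suc n)"
    using B_subset_Z by blast
  then show ?thesis
    by (simp add: cohom_order_def add_index_self[OF B_subgroup])
qed

section \<open>Summation along the integers and along free flows\<close>

definition int_sum :: "(int \<Rightarrow> 'a::ab_group_add) \<Rightarrow> int \<Rightarrow> 'a"
  where "int_sum F k = (if 0 \<le> k then \<Sum>j\<in>{0..<k}. F j else - (\<Sum>j\<in>{k..<0}. F j))"

text \<open>The sum is signed so that the recurrence holds at negative integers too: it is the
  antiderivative of \<open>F\<close> vanishing at 0.\<close>

lemma int_sum_Suc: "int_sum F (k + 1) = int_sum F k + F k"
proof -
  have "{0..<k + 1} = insert k {0..<k}" if "0 \<le> k"
    using that by auto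
  moreover have "{k..<0} = insert k {k + 1..<0}" if "k < 0"
    using that by auto
  \<comment> \<open>At k = -1 the two branches of the definition meet.\<close>
  ultimately show ?thesis
    by (cases "k = - 1") (auto simp: int_sum_def)
qed

lemma int_sum_in:
  assumes "add_subgroup A" "\<And>j. F j \<in> A"
  shows "int_sum F k \<in> A"
proof -
  have "(\<Sum>j\<in>J. F j) \<in> A" for J
    by (induction J rule: infinite_finite_induct)
      (auto simp: assms add_subgroup_zero add_subgroup_add)
  then show ?thesis
    by (simp add: int_sum_def add_subgroup_uminus[OF assms(1)])
qed

definition shift_diff :: "('x \<Rightarrow> 'x) \<Rightarrow> ('x list \<Rightarrow> 'a::ab_group_add) \<Rightarrow> 'x list \<Rightarrow> 'a"
  where "shift_diff s f = (\<lambda>xs. f (map s xs) - f xs)"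

text \<open>The function \<open>\<kappa>\<close> is a coordinate along the orbits of the flow \<open>S\<close>, which shows
  that the flow acts freely on the orbits of \<open>K\<close>. Hence every cochain invariant under \<open>K\<close> is
  the increment of another one along the flow.\<close>

locale free_flow =
  fixes A :: "'a::ab_group_add set" and K :: "('x \<Rightarrow> 'x) set"
    and S :: "int \<Rightarrow> 'x \<Rightarrow> 'x" and \<kappa> :: "'x \<Rightarrow> int"
  assumes A_subgroup: "add_subgroup A"
    and S_zero: "S 0 x = x"
    and S_add: "S (i + j) x = S i (S j x)"
    and \<kappa>_S: "\<kappa> (S j x) = \<kappa> x + j"
    and \<kappa>_K: "k \<in> K \<Longrightarrow> \<kappa> (k x) = \<kappa> x"
    and normalizes: "k \<in> K \<Longrightarrow> \<exists>k'\<in>K. \<forall>x. S j (k x) = k' (S j x)"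
begin

lemma map_S_add: "map (S i) (map (S j) xs) = map (S (i + j)) xs"
  by (simp add: S_add)

lemma map_S_K:
  assumes "f \<in> cochains A K n" "k \<in> K"
  shows "f (map (S j) (map k xs)) = f (map (S j) xs)"
proof -
  obtain k' where k': "k' \<in> K" "\<forall>x. S j (k x) = k' (S j x)"
    using normalizes[OF assms(2)] by blast
  then have "map (S j) (map k xs) = map k' (map (S j) xs)"
    by simp
  then show ?thesis
    using cochainsD(3)[OF assms(1) k'(1)] by metis
qed

text \<open>Each orbit of the flow is a copy of the integers through \<kappa>, so \<open>h\<close>
  can be summed along it from level 0 to the level of the first entry.\<close>

lemma shift_diff_onto:
  assumes h: "h \<in> cochains A K n"
  shows "h \<in> shift_diff (S 1) ` cochains A K n"
proof -
  \<comment> \<open>\<open>F xs j\<close> is the value of \<open>h\<close> at the point of the flow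
    orbit of \<open>xs\<close> whose first entry has level \<open>j\<close>; it depends on the orbit
    only, and at the level of \<open>xs\<close> itself it is \<open>h xs\<close>.\<close>
  define F where "F = (\<lambda>xs j. h (map (S (j - \<kappa> (hd xs))) xs))"
  define f where "f = (\<lambda>xs. if xs = [] then 0 else int_sum (F xs) (\<kappa> (hd xs)))"
  have h_nil: "h [] = 0"
    using cochainsD(2)[OF h] by simp
  have "f \<in> cochains A K n"
  proof (rule cochainsI)
    show "f xs \<in> A" for xs
      using int_sum_in[OF A_subgroup] cochainsD(1)[OF h] add_subgroup_zero[OF A_subgroup]
      by (simp add: f_def F_def)
    show "f xs = 0" if "length xs \<noteq> Suc n" for xs
    proof -
      have "F xs = (\<lambda>_. 0)"
        using that by (simp add: F_def cochainsD(2)[OF h])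
      then show ?thesis
        by (simp add: f_def int_sum_def)
    qed
    show "f (map k xs) = f xs" if k: "k \<in> K" for k xs
    proof (cases xs)
      case (Cons x ys)
      then have "F (map k xs) = F xs"
        using map_S_K[OF h k, of _ xs] by (auto simp: F_def \<kappa>_K[OF k])
      then show ?thesis
        using Cons by (simp add: f_def \<kappa>_K[OF k])
    qed (simp add: f_def)
  qed
  moreover have "shift_diff (S 1) f = h"
  proof
    fix xs
    show "shift_diff (S 1) f xs = h xs"
    proof (cases xs)
      case (Cons x ys)
      have "F (map (S 1) xs) = F xs"
        unfolding F_def map_S_add by (simp add: Cons \<kappa>_S)
      moreover have "F xs (\<kappa> x) = h xs"
        using S_zero by (simp add: F_def Cons map_idI)
      ultimately show ?thesis
        using int_sum_Suc[of "F xs" "\<kappa> x"] by (simp add: shift_diff_def f_def Cons \<kappa>_S)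
    qed (simp add: shift_diff_def h_nil)
  qed
  ultimately show ?thesis
    by blast
qed

sublocale add_complex_endo "cochains A K" simplicial_diff "shift_diff (S 1)"
proof -
  interpret add_complex "cochains A K" simplicial_diff
    by (rule add_complex_cochains[OF A_subgroup])
  show "add_complex_endo (cochains A K) simplicial_diff (shift_diff (S 1))"
  proof
    show "shift_diff (S 1) (f - g) = shift_diff (S 1) f - shift_diff (S 1) g" for f g :: "'x list \<Rightarrow> 'a"
      by (simp add: shift_diff_def fun_eq_iff)
    have "shift_diff (S 1) f \<in> cochains A K n" if f: "f \<in> cochains A K n" for f n
    proof (rule cochainsI)
      show "shift_diff (S 1) f xs \<in> A" for xs
        using cochainsD(1)[OF f] add_subgroup_diff[OF A_subgroup] by (simp add: shift_diff_def)
      show "shift_diff (S 1) f xs = 0" if "length xs \<noteq> Suc n" for xs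
        using that by (simp add: shift_diff_def cochainsD(2)[OF f])
      show "shift_diff (S 1) f (map k xs) = shift_diff (S 1) f xs" if k: "k \<in> K" for k xs
        using map_S_K[OF f k, of 1 xs] cochainsD(3)[OF f k] by (simp add: shift_diff_def)
    qed
    then show "shift_diff (S 1) ` cochains A K n = cochains A K n" for n
      using shift_diff_onto by blast
    show "simplicial_diff (shift_diff (S 1) f) = shift_diff (S 1) (simplicial_diff f)" for f :: "'x list \<Rightarrow> 'a"
      by (simp add: shift_diff_def fun_eq_iff simplicial_diff_minus simplicial_diff_map)
  qed
qed

text \<open>Invariance under \<open>S 1\<close> propagates to all \<open>S j\<close>, and the third
  assumption reduces \<open>K'\<close> to these and \<open>K\<close>. The identity is adjoined
  because \<open>K\<close> may be empty.\<close>

lemma kernel_shift_diff: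
  assumes "K \<subseteq> K'" "S 1 \<in> K'" "\<And>k'. k' \<in> K' \<Longrightarrow> \<exists>k\<in>insert id K. \<exists>j. k' = k \<circ> S j"
  shows "{f \<in> cochains A K n. shift_diff (S 1) f = 0} = cochains A K' n"
proof (intro equalityI subsetI)
  fix f assume "f \<in> {f \<in> cochains A K n. shift_diff (S 1) f = 0}"
  then have f: "f \<in> cochains A K n" and "shift_diff (S 1) f = 0"
    by auto
  then have S1: "f (map (S 1) xs) = f xs" for xs
    by (simp add: shift_diff_def fun_eq_iff)
  have Sj: "f (map (S j) xs) = f xs" for j xs
  proof (induction j rule: int_induct[where k = 0])
    case base
    show ?case
      using S_zero by (simp add: map_idI)
  next
    case (step1 i)
    then show ?case
      using S1[of "map (S i) xs"] by (simp only: map_S_add add.commute)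
  next
    case (step2 i)
    then show ?case
      using S1[of "map (S (i - 1)) xs"] by (simp only: map_S_add) simp
  qed
  show "f \<in> cochains A K' n"
  proof (rule cochainsI)
    fix k' xs assume "k' \<in> K'"
    then obtain k j where k: "k \<in> insert id K" "k' = k \<circ> S j"
      using assms(3) by blast
    then have "f (map k' xs) = f (map k (map (S j) xs))"
      by (simp add: comp_assoc)
    also have "\<dots> = f (map (S j) xs)"
      using k(1) cochainsD(3)[OF f, of k "map (S j) xs"] by (auto simp del: map_map)
    finally show "f (map k' xs) = f xs"
      by (simp add: Sj)
  qed (use cochainsD[OF f] in auto)
next
  fix f assume f: "f \<in> cochains A K' n"
  then have "shift_diff (S 1) f = 0"
    using cochainsD(3)[OF f assms(2)] by (simp add: shift_diff_def fun_eq_iff)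
  moreover have "f \<in> cochains A K n"
    using f assms(1) by (auto simp: cochains_def)
  ultimately show "f \<in> {f \<in> cochains A K n. shift_diff (S 1) f = 0}"
    by blast
qed

lemma Fix_0: "Fix 0 = Z 0"
proof -
  have "shift_diff (S 1) f = 0" if "f \<in> Z 0" for f
  proof
    fix xs
    show "shift_diff (S 1) f xs = 0 xs"
    proof (cases "length xs = 1")
      case True
      then obtain x where "xs = [x]"
        by (auto simp: length_Suc_conv)
      moreover have "f [S 1 x] = f [x]"
        using that unfolding cocycles_0_iff by blast
      ultimately show ?thesis
        by (simp add: shift_diff_def)
    next
      case False
      then show ?thesis
        using that cochainsD(2)[of f A K 0] by (simp add: shift_diff_def cocycles_0_iff)
    qed
  qed
  then show ?thesis
    by (auto simp: Fix_def cx_coboundaries_def)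
qed

text \<open>A map commuting with \<open>K\<close> is homotopic to the identity. In degree 1 the
  homotopy sends f to x -> f[x, S x], and the cocycle identity on both paths from x to S y, through
  y and through S x, gives the claim. The cohomology of <a> vanishes above degree 1, so this case is
  enough for b.\<close>

lemma Fix_1_if_commute:
  assumes "\<And>k x. k \<in> K \<Longrightarrow> S 1 (k x) = k (S 1 x)"
  shows "Fix 1 = Z 1"
proof -
  have "shift_diff (S 1) f \<in> B 1" if f: "f \<in> Z 1" for f
  proof -
    define g where "g = (\<lambda>xs. if length xs = 1 then f [hd xs, S 1 (hd xs)] else 0)"
    have fc: "f \<in> cochains A K 1"
      using f by (simp add: cx_cocycles_def)
    have cocycle: "f [x, z] = f [x, y] + f [y, z]" for x y z
      using f cocycle_1_iff[OF fc] by blast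
    have "g \<in> cochains A K 0"
    proof (rule cochainsI)
      show "g xs \<in> A" for xs
        using cochainsD(1)[OF fc] add_subgroup_zero[OF A_subgroup] by (simp add: g_def)
      show "g (map k xs) = g xs" if "k \<in> K" for k xs
        using cochainsD(3)[OF fc that, of "[hd xs, S 1 (hd xs)]"] assms[OF that]
        by (cases xs) (auto simp: g_def)
    qed (simp add: g_def)
    moreover have "simplicial_diff g = shift_diff (S 1) f"
    proof
      fix xs
      show "simplicial_diff g xs = shift_diff (S 1) f xs"
      proof (cases "length xs = 2")
        case True
        then obtain x y where xs: "xs = [x, y]"
          by (auto simp: length_Suc_conv numeral_2_eq_2)
        have "f [y, S 1 y] - f [x, S 1 x] = f [S 1 x, S 1 y] - f [x, y]"
          using cocycle[of x "S 1 y" y] cocycle[of x "S 1 y" "S 1 x"] by (simp add: algebra_simps)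
        then show ?thesis
          by (simp add: xs g_def shift_diff_def)
      next
        case False
        then show ?thesis
          using cochainsD(2)[OF fc] by (simp add: shift_diff_def simplicial_diff_eq_0 g_def)
      qed
    qed
    ultimately have "shift_diff (S 1) f \<in> simplicial_diff ` cochains A K 0"
      by (metis imageI)
    then show ?thesis
      by (simp add: cx_coboundaries_def)
  qed
  then show ?thesis
    by (auto simp: Fix_def)
qed

end

section \<open>Cochains on the torus bundle group\<close>

context add_complex
begin

text \<open>Counting replaces the construction of primitives: \<Phi> induces a map from a finite
  group onto a set of the same order, so it is injective on cohomology.\<close>

lemma kernel_eq_coboundaries:
  fixes \<Phi> :: "'a \<Rightarrow> 'b::ab_group_add"
  assumes "\<And>x y. x \<in> Z n \<Longrightarrow> y \<in> Z n \<Longrightarrow> \<Phi> (x - y) = \<Phi> x - \<Phi> y"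
    and "\<And>x. x \<in> B n \<Longrightarrow> \<Phi> x = 0" "\<Phi> ` Z n = V" "card V = cohom_order d E n" "card V \<noteq> 0"
  shows "{z \<in> Z n. \<Phi> z = 0} = B n"
proof -
  define L where "L = {z \<in> Z n. \<Phi> z = 0}"
  have L: "add_subgroup L"
  proof -
    have "\<Phi> 0 = 0"
      using assms(1)[OF add_subgroup_zero add_subgroup_zero, OF Z_subgroup Z_subgroup] by simp
    then show ?thesis
      using Z_subgroup[of n] by (auto simp: L_def add_subgroup_def assms(1))
  qed
  have BL: "B n \<subseteq> L"
    using assms(2) B_subset_Z by (auto simp: L_def)
  have "add_index V {0} = add_index (Z n) {z \<in> Z n. \<Phi> z \<in> {0}}"
  proof (rule add_index_vimage)
    show "\<exists>x\<in>Z n. q - \<Phi> x \<in> {0}" if "q \<in> V" for q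
      using that assms(3) by force
  qed (use assms(1,3) Z_subgroup in \<open>auto simp: add_subgroup_def\<close>)
  then have "card V = add_index (Z n) L"
    by (simp add: add_index_zero L_def)
  moreover have "add_index (Z n) (B n) = add_index (Z n) L * add_index L (B n)"
    by (intro add_index_tower Z_subgroup B_subgroup L BL) (auto simp: L_def)
  ultimately have "add_index L (B n) = 1"
    using assms(4,5) by (simp add: cohom_order_def)
  then have "L = B n"
    using add_index_one_imp_subset[OF L B_subgroup] BL by blast
  then show ?thesis
    by (simp add: L_def)
qed

end

type_synonym torus_element = "(int ^ 2) \<times> int"

text \<open>Left multiplication by \<open>(u, 0)\<close> in the torus bundle group.\<close>

definition translation :: "int ^ 2 \<Rightarrow> torus_element \<Rightarrow> torus_element"
  where "translation u = (\<lambda>(v, k). (u + v, k))"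

abbreviation basis1 :: "int ^ 2" where "basis1 \<equiv> axis 1 1"
abbreviation basis2 :: "int ^ 2" where "basis2 \<equiv> axis 2 1"

lemma axis_nth_2:
  fixes m :: int
  shows "(axis 1 m :: int ^ 2) $ 1 = m" "(axis 1 m :: int ^ 2) $ 2 = 0"
    "(axis 2 m :: int ^ 2) $ 1 = 0" "(axis 2 m :: int ^ 2) $ 2 = m"
  by (simp_all add: axis_def)

lemma axis_add: "(axis i (m + n) :: int ^ 'n) = axis i m + axis i n"
  by (simp add: vec_eq_iff axis_def)

lemma axis_zero_entry: "(axis i 0 :: int ^ 'n) = 0"
  by (simp add: vec_eq_iff axis_def)

text \<open>The coefficient group is the image of \<open>\<iota>\<close>, a copy of the integers modulo \<open>p\<close> inside an
  abelian group type.\<close>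

locale cyclic_coeffs =
  fixes \<iota> :: "int \<Rightarrow> 'a::ab_group_add" and p :: nat
  assumes iota_add: "\<iota> (x + y) = \<iota> x + \<iota> y"
    and iota_eq_0: "\<iota> x = 0 \<longleftrightarrow> int p dvd x"
    and prime_p: "Factorial_Ring.prime p"
begin

lemma iota_zero: "\<iota> 0 = 0"
  by (simp add: iota_eq_0)

lemma iota_diff: "\<iota> (x - y) = \<iota> x - \<iota> y"
  using iota_add[of "x - y" y] by simp

lemma iota_eq_iff: "\<iota> x = \<iota> y \<longleftrightarrow> int p dvd x - y"
  using iota_eq_0[of "x - y"] by (simp add: iota_diff)

lemma p_pos: "p > 0"
  using prime_p prime_gt_0_nat by blast

lemma range_iota_subgroup: "add_subgroup (range \<iota>)"
  by (rule add_subgroupI) (use iota_zero in \<open>auto simp flip: iota_diff intro: range_eqI[of _ _ 0]\<close>)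

lemma inj_on_iota: "inj_on \<iota> {0..<int p}"
  by (rule inj_onI) (auto simp: iota_eq_iff simp flip: mod_eq_dvd_iff)

lemma range_iota: "range \<iota> = \<iota> ` {0..<int p}"
proof (intro equalityI subsetI)
  fix a assume "a \<in> range \<iota>"
  then obtain x where "a = \<iota> x"
    by blast
  also have "\<iota> x = \<iota> (x mod int p)"
    by (simp add: iota_eq_iff)
  finally show "a \<in> \<iota> ` {0..<int p}"
    using p_pos by simp
qed auto

lemma card_range_iota: "card (range \<iota>) = p"
  using card_image[OF inj_on_iota] by (simp add: range_iota)

end

text \<open>\<open>P\<close> is the family of powers of \<open>\<theta>\<close>.\<close>

locale torus_cochains = cyclic_coeffs +
  fixes \<theta> :: "int ^ 2 ^ 2" and P :: "int \<Rightarrow> int ^ 2 \<Rightarrow> int ^ 2"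
  assumes P_zero: "P 0 v = v"
    and P_add_exp: "P (i + j) v = P i (P j v)"
    and P_one: "P 1 v = \<theta> *v v"
    and P_add: "P i (u + v) = P i u + P i v"
begin

definition K1 where "K1 = range (\<lambda>m. translation (axis 1 m))"
definition K2 where "K2 = range translation"
text \<open>Left multiplication by \<open>(0, j)\<close>, that is, by t^j. Together with the
  translations it yields all left multiplications, collected in \<open>K3\<close>; \<open>K1\<close>
  and \<open>K2\<close> collect those by <a> and <a, b>.\<close>

definition flow_t where "flow_t j = (\<lambda>(v, k). (P j v, j + k))"
definition K3 where "K3 = range (\<lambda>(u, j). translation u \<circ> flow_t j)"

abbreviation C :: "(torus_element \<Rightarrow> torus_element) set \<Rightarrow> nat \<Rightarrow> (torus_element list \<Rightarrow> 'a) set"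
  where "C K \<equiv> cochains (range \<iota>) K"

sublocale flow_a: free_flow "range \<iota>" "{}" "\<lambda>m. translation (axis 1 m)" "\<lambda>x. fst x $ 1"
  by unfold_locales
    (auto simp: range_iota_subgroup translation_def axis_zero_entry axis_add axis_nth_2 split: prod.splits)

sublocale flow_b: free_flow "range \<iota>" K1 "\<lambda>m. translation (axis 2 m)" "\<lambda>x. fst x $ 2"
  by unfold_locales
    (auto simp: range_iota_subgroup translation_def axis_zero_entry axis_add axis_nth_2 K1_def
      split: prod.splits intro!: add.left_commute)

text \<open>Here t need not commute with the translations, but t^j u = \<theta>^j(u) t^j; normality
  of <a, b> is what \<open>normalizes\<close> asks for.\<close>

sublocale flow_t: free_flow "range \<iota>" K2 flow_t snd
proof
  show "\<exists>k'\<in>K2. \<forall>x. flow_t j (k x) = k' (flow_t j x)" if k: "k \<in> K2" for k j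
  proof -
    obtain u where "k = translation u"
      using k by (auto simp: K2_def)
    then have "\<forall>x. flow_t j (k x) = translation (P j u) (flow_t j x)"
      by (simp add: translation_def flow_t_def P_add split: prod.splits)
    then show ?thesis
      unfolding K2_def by blast
  qed
qed (auto simp: range_iota_subgroup translation_def flow_t_def P_zero P_add_exp K2_def split: prod.splits)

lemma kernel_a: "{f \<in> C {} n. shift_diff (translation basis1) f = 0} = C K1 n"
  by (rule flow_a.kernel_shift_diff) (auto simp: K1_def)

lemma kernel_b: "{f \<in> C K1 n. shift_diff (translation basis2) f = 0} = C K2 n"
proof (rule flow_b.kernel_shift_diff)
  fix k' assume "k' \<in> K2"
  then obtain u where u: "k' = translation u"
    by (auto simp: K2_def)
  have "u = axis 1 (u $ 1) + axis 2 (u $ 2)"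
    by (simp add: vec_eq_iff forall_2 axis_nth_2)
  then have "k' = translation (axis 1 (u $ 1)) \<circ> translation (axis 2 (u $ 2))"
    by (auto simp: u translation_def fun_eq_iff add.assoc[symmetric])
  moreover have "translation (axis 1 (u $ 1)) \<in> K1"
    by (simp add: K1_def)
  ultimately show "\<exists>k\<in>insert id K1. \<exists>j. k' = k \<circ> translation (axis 2 j)"
    by blast
qed (auto simp: K1_def K2_def)

lemma kernel_t: "{f \<in> C K2 n. shift_diff (flow_t 1) f = 0} = C K3 n"
proof (rule flow_t.kernel_shift_diff)
  have 1: "translation u = translation u \<circ> flow_t 0" for u
    by (simp add: fun_eq_iff flow_t_def P_zero)
  have 2: "flow_t 1 = translation 0 \<circ> flow_t 1"
    by (simp add: fun_eq_iff translation_def split: prod.splits)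
  show "K2 \<subseteq> K3"
    unfolding K2_def K3_def using 1 by (auto intro: range_eqI[of _ _ "(u, 0)" for u])
  show "flow_t 1 \<in> K3"
    unfolding K3_def using 2 by (auto intro: range_eqI[of _ _ "(0, 1)"])
qed (auto simp: K2_def K3_def)

text \<open>The cohomology of a circle: the constants, which a fixes, reappear as the cokernel in
  degree 1.\<close>

lemma order_K1:
  "cohom_order simplicial_diff (C K1) 0 = p"
  "cohom_order simplicial_diff (C K1) 1 = p"
  "cohom_order simplicial_diff (C K1) (Suc (Suc n)) = 1"
proof -
  let ?h = "cohom_order simplicial_diff (C {})" and ?k = "\<lambda>n. add_index (flow_a.Fix n) (flow_a.B n)"
  have h: "?h 0 = p" "?h (Suc n) = 1" for n
    using cohom_order_cochains_0[OF range_iota_subgroup] card_range_iota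
      cohom_order_cochains_no_invariance[OF range_iota_subgroup] by auto
  have k: "?k 0 = p" "?k (Suc n) = 1" for n
    using h(1) flow_a.Fix_0 flow_a.Fix_eq_B_if_trivial[OF h(2)] add_index_self[OF flow_a.B_subgroup]
    by (simp_all add: cohom_order_def)
  have "cohom_order simplicial_diff (C K1) (Suc n) = ?k (Suc n) * ?k n" for n
    using flow_a.cohom_order_kernel_Suc[of n] h p_pos by (cases n) (simp_all add: kernel_a)
  from this[of 0] this[of "Suc n"] k
  show "cohom_order simplicial_diff (C K1) 1 = p" "cohom_order simplicial_diff (C K1) (Suc (Suc n)) = 1"
    by simp_all
  show "cohom_order simplicial_diff (C K1) 0 = p"
    using cohom_order_cochains_0[OF range_iota_subgroup] card_range_iota by simp
qed

text \<open>The exponents 1, 2, 1 of the torus arise from the exponents 1, 1 of the circle by adding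
  a shifted copy, since b acts trivially on cohomology.\<close>

lemma order_K2:
  "cohom_order simplicial_diff (C K2) 0 = p"
  "cohom_order simplicial_diff (C K2) 1 = p * p"
  "cohom_order simplicial_diff (C K2) 2 = p"
  "cohom_order simplicial_diff (C K2) (Suc (Suc (Suc n))) = 1"
proof -
  let ?h = "cohom_order simplicial_diff (C K1)" and ?k = "\<lambda>n. add_index (flow_b.Fix n) (flow_b.B n)"
  have Fix1: "flow_b.Fix 1 = flow_b.Z 1"
    by (rule flow_b.Fix_1_if_commute) (auto simp: K1_def translation_def add.left_commute split: prod.splits)
  have k: "?k 0 = p" "?k (Suc 0) = p" "?k (Suc (Suc n)) = 1" for n
    using order_K1 flow_b.Fix_0 Fix1 flow_b.Fix_eq_B_if_trivial[OF order_K1(3)]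
      add_index_self[OF flow_b.B_subgroup]
    by (simp_all add: cohom_order_def)
  have h: "?h n \<noteq> 0" for n
    using order_K1 p_pos by (cases n; cases "n - 1") auto
  have "cohom_order simplicial_diff (C K2) (Suc n) = ?k (Suc n) * ?k n" for n
    using flow_b.cohom_order_kernel_Suc[OF h[of n]] by (simp add: kernel_b)
  from this[of 0] this[of 1] this[of "Suc (Suc n)"] k
  show "cohom_order simplicial_diff (C K2) 1 = p * p" "cohom_order simplicial_diff (C K2) 2 = p"
    "cohom_order simplicial_diff (C K2) (Suc (Suc (Suc n))) = 1"
    by (simp_all add: numeral_2_eq_2)
  show "cohom_order simplicial_diff (C K2) 0 = p"
    using cohom_order_cochains_0[OF range_iota_subgroup] card_range_iota by simp
qed

section \<open>Explicit cocycles for <a, b> and the action of t on their classes\<close>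

definition lin_cocycle :: "int \<Rightarrow> int \<Rightarrow> torus_element list \<Rightarrow> 'a"
  where "lin_cocycle c1 c2 xs = (case xs of
      [x, y] \<Rightarrow> \<iota> (c1 * (fst y - fst x) $ 1 + c2 * (fst y - fst x) $ 2)
    | _ \<Rightarrow> 0)"

text \<open>The cup product of the two coordinate cocycles, scaled by \<open>m\<close>.\<close>

definition det_cocycle :: "int \<Rightarrow> torus_element list \<Rightarrow> 'a"
  where "det_cocycle m xs = (case xs of
      [x, y, z] \<Rightarrow> \<iota> (m * ((fst y - fst x) $ 1 * (fst z - fst y) $ 2))
    | _ \<Rightarrow> 0)"

definition eval1 :: "(torus_element list \<Rightarrow> 'a) \<Rightarrow> 'a \<times> 'a"
  where "eval1 f = (f [(0, 0), (basis1, 0)], f [(0, 0), (basis2, 0)])"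

text \<open>The two triangles of the unit square, with opposite signs, form the fundamental cycle of
  the torus.\<close>

definition eval2 :: "(torus_element list \<Rightarrow> 'a) \<Rightarrow> 'a"
  where "eval2 f = f [(0, 0), (basis1, 0), (basis1 + basis2, 0)] - f [(0, 0), (basis2, 0), (basis1 + basis2, 0)]"

lemma eval1_diff: "eval1 (f - g) = eval1 f - eval1 g"
  by (simp add: eval1_def)

lemma eval2_diff: "eval2 (f - g) = eval2 f - eval2 g"
  by (simp add: eval2_def)

lemma translation_pair: "translation u (v, k) = (u + v, k)"
  by (simp add: translation_def)

lemma cochain_translation:
  assumes "f \<in> C K2 n"
  shows "f (map (translation u) xs) = f xs"
  using cochainsD(3)[OF assms] by (simp add: K2_def)

lemma eval1_coboundary:
  assumes "f \<in> flow_t.B 1"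
  shows "eval1 f = 0"
proof -
  obtain g where g: "g \<in> C K2 0" "f = simplicial_diff g"
    using assms by (auto simp: cx_coboundaries_def)
  have "g [(u, 0)] = g [(0, 0)]" for u
    using cochain_translation[OF g(1), of u "[(0, 0)]"] by (simp add: translation_pair)
  then show ?thesis
    by (simp add: eval1_def g(2) zero_prod_def)
qed

text \<open>The diagonal of the square cancels, and translation invariance identifies opposite
  sides, which then cancel as well.\<close>

lemma eval2_coboundary:
  assumes "f \<in> flow_t.B 2"
  shows "eval2 f = 0"
proof -
  obtain g where g: "g \<in> C K2 1" "f = simplicial_diff g"
    using assms by (auto simp: cx_coboundaries_def numeral_2_eq_2)
  have "g [(basis1, 0), (basis1 + basis2, 0)] = g [(0, 0), (basis2, 0)]"
    "g [(basis2, 0), (basis1 + basis2, 0)] = g [(0, 0), (basis1, 0)]"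
    using cochain_translation[OF g(1), of basis1 "[(0, 0), (basis2, 0)]"]
      cochain_translation[OF g(1), of basis2 "[(0, 0), (basis1, 0)]"]
    by (simp_all add: translation_pair add.commute)
  then show ?thesis
    by (simp add: eval2_def g(2))
qed

lemma lin_cocycle_cocycle: "lin_cocycle c1 c2 \<in> flow_t.Z 1"
proof -
  have *: "lin_cocycle c1 c2 \<in> C K2 1"
  proof (rule cochainsI)
    show "lin_cocycle c1 c2 xs \<in> range \<iota>" for xs
      using iota_zero by (auto simp: lin_cocycle_def split: list.split intro: range_eqI[of _ _ 0])
    show "lin_cocycle c1 c2 xs = 0" if "length xs \<noteq> Suc 1" for xs
      using that by (auto simp: lin_cocycle_def split: list.split)
    show "lin_cocycle c1 c2 (map k xs) = lin_cocycle c1 c2 xs" if "k \<in> K2" for k xs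
      using that by (auto simp: lin_cocycle_def K2_def translation_def split: list.split prod.split)
  qed
  show ?thesis
    using cocycle_1_iff[OF *]
    by (auto simp: lin_cocycle_def algebra_simps simp flip: iota_add)
qed

lemma simplicial_diff_det_cocycle: "simplicial_diff (det_cocycle m) = 0"
proof
  fix xs :: "torus_element list"
  show "simplicial_diff (det_cocycle m) xs = 0 xs"
  proof (cases "length xs = 4")
    case True
    then obtain x y z w where "xs = [x, y, z, w]"
      by (auto simp: length_Suc_conv numeral_eq_Suc)
    then show ?thesis
      by (simp add: det_cocycle_def iota_zero algebra_simps flip: iota_add iota_diff)
  next
    case False
    then show ?thesis
      by (intro trans[OF simplicial_diff_eq_0]) (auto simp: det_cocycle_def split: list.split)
  qed
qed

lemma det_cocycle_cocycle: "det_cocycle m \<in> flow_t.Z 2"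
proof -
  have "det_cocycle m \<in> C K2 2"
  proof (rule cochainsI)
    show "det_cocycle m xs \<in> range \<iota>" for xs
      using iota_zero by (auto simp: det_cocycle_def split: list.split intro: range_eqI[of _ _ 0])
    show "det_cocycle m xs = 0" if "length xs \<noteq> Suc 2" for xs
      using that by (auto simp: det_cocycle_def split: list.split)
    show "det_cocycle m (map k xs) = det_cocycle m xs" if "k \<in> K2" for k xs
      using that by (auto simp: det_cocycle_def K2_def translation_def split: list.split prod.split)
  qed
  then show ?thesis
    using simplicial_diff_det_cocycle by (simp add: cx_cocycles_def)
qed

lemma eval1_lin_cocycle: "eval1 (lin_cocycle c1 c2) = (\<iota> c1, \<iota> c2)"
  by (simp add: eval1_def lin_cocycle_def axis_nth_2)

lemma eval2_det_cocycle: "eval2 (det_cocycle m) = \<iota> m"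
  by (simp add: eval2_def det_cocycle_def axis_nth_2 iota_zero)

lemma in_range_iota_prod: "a \<in> range \<iota> \<times> range \<iota> \<Longrightarrow> \<exists>c1 c2. a = (\<iota> c1, \<iota> c2)"
  by auto

lemma eval1_image: "eval1 ` flow_t.Z 1 = range \<iota> \<times> range \<iota>"
proof (intro equalityI subsetI)
  fix a assume "a \<in> range \<iota> \<times> range \<iota>"
  then show "a \<in> eval1 ` flow_t.Z 1"
    using in_range_iota_prod lin_cocycle_cocycle eval1_lin_cocycle by (metis imageI)
next
  fix a assume "a \<in> eval1 ` flow_t.Z 1"
  then obtain f where "f \<in> C K2 1" "a = eval1 f"
    by (auto simp: cx_cocycles_def)
  then show "a \<in> range \<iota> \<times> range \<iota>"
    using cochainsD(1) unfolding eval1_def by blast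
qed

lemma eval2_image: "eval2 ` flow_t.Z 2 = range \<iota>"
proof (intro equalityI subsetI)
  fix a assume "a \<in> range \<iota>"
  then obtain m where "a = eval2 (det_cocycle m)"
    by (auto simp: eval2_det_cocycle)
  then show "a \<in> eval2 ` flow_t.Z 2"
    using det_cocycle_cocycle by blast
next
  fix a assume "a \<in> eval2 ` flow_t.Z 2"
  then obtain f where "f \<in> C K2 2" "a = eval2 f"
    by (auto simp: cx_cocycles_def)
  then show "a \<in> range \<iota>"
    by (simp add: eval2_def cochainsD(1) add_subgroup_diff[OF range_iota_subgroup])
qed

text \<open>The explicit cocycles attain all p^2 values, as many as there are classes, so
  \<open>eval1\<close> separates the classes.\<close>

lemma ker_eval1: "{f \<in> flow_t.Z 1. eval1 f = 0} = flow_t.B 1"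
  by (rule flow_t.kernel_eq_coboundaries[OF _ _ eval1_image])
    (use p_pos in \<open>simp_all add: eval1_diff eval1_coboundary[unfolded One_nat_def] card_range_iota card_cartesian_product
      order_K2[unfolded One_nat_def]\<close>)

lemma ker_eval2: "{f \<in> flow_t.Z 2. eval2 f = 0} = flow_t.B 2"
  by (rule flow_t.kernel_eq_coboundaries[OF _ _ eval2_image])
    (use p_pos in \<open>simp_all add: eval2_diff eval2_coboundary card_range_iota order_K2\<close>)

abbreviation "D \<equiv> shift_diff (flow_t 1)"

lemma eval1_shift:
  assumes f: "f \<in> flow_t.Z 1" and c: "eval1 f = (\<iota> c1, \<iota> c2)"
  shows "eval1 (D f) = (\<iota> (c1 * (\<theta> - mat 1) $ 1 $ 1 + c2 * (\<theta> - mat 1) $ 2 $ 1),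
    \<iota> (c1 * (\<theta> - mat 1) $ 1 $ 2 + c2 * (\<theta> - mat 1) $ 2 $ 2))"
proof -
  \<comment> \<open>By \<open>ker_eval1\<close> this difference is a coboundary, and D preserves
    coboundaries. So the formula need only be checked on the explicit cocycle, where it is the row
    vector (c1, c2) times \<theta> - I.\<close>
  have "f - lin_cocycle c1 c2 \<in> {f \<in> flow_t.Z 1. eval1 f = 0}"
    using f c lin_cocycle_cocycle
    by (simp add: eval1_diff eval1_lin_cocycle add_subgroup_diff[OF flow_t.Z_subgroup])
  then have "D (f - lin_cocycle c1 c2) \<in> flow_t.B 1"
    unfolding ker_eval1 by (rule flow_t.D_in_B)
  then have "eval1 (D f) = eval1 (D (lin_cocycle c1 c2))"
    using eval1_coboundary[of "D f - D (lin_cocycle c1 c2)"] by (simp add: flow_t.D_diff eval1_diff)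
  also have "\<dots> = (\<iota> (c1 * (\<theta> *v basis1) $ 1 + c2 * (\<theta> *v basis1) $ 2) - \<iota> c1,
      \<iota> (c1 * (\<theta> *v basis2) $ 1 + c2 * (\<theta> *v basis2) $ 2) - \<iota> c2)"
    by (simp add: eval1_def shift_diff_def lin_cocycle_def flow_t_def P_one axis_nth_2)
  also have "\<dots> = (\<iota> (c1 * (\<theta> - mat 1) $ 1 $ 1 + c2 * (\<theta> - mat 1) $ 2 $ 1),
    \<iota> (c1 * (\<theta> - mat 1) $ 1 $ 2 + c2 * (\<theta> - mat 1) $ 2 $ 2))"
    by (simp add: matrix_vector_mult_def sum_2 axis_nth_2 mat_def algebra_simps flip: iota_diff)
  finally show ?thesis .
qed

lemma eval2_shift:
  assumes f: "f \<in> flow_t.Z 2" and m: "eval2 f = \<iota> m"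
  shows "eval2 (D f) = \<iota> (m * (det \<theta> - 1))"
proof -
  have "f - det_cocycle m \<in> {f \<in> flow_t.Z 2. eval2 f = 0}"
    using f m det_cocycle_cocycle
    by (simp add: eval2_diff eval2_det_cocycle add_subgroup_diff[OF flow_t.Z_subgroup])
  then have "D (f - det_cocycle m) \<in> flow_t.B 2"
    unfolding ker_eval2 by (rule flow_t.D_in_B)
  then have "eval2 (D f) = eval2 (D (det_cocycle m))"
    using eval2_coboundary[of "D f - D (det_cocycle m)"] by (simp add: flow_t.D_diff eval2_diff)
  \<comment> \<open>On the image of the square under \<theta> the two triangles give the two terms
    of the determinant; the original square contributes the -1.\<close>
  also have "\<dots> = \<iota> (m * ((\<theta> *v basis1) $ 1 * (\<theta> *v basis2) $ 2))
      - \<iota> (m * ((\<theta> *v basis2) $ 1 * (\<theta> *v basis1) $ 2)) - \<iota> m"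
    by (simp add: eval2_def shift_diff_def det_cocycle_def flow_t_def P_one axis_nth_2
        matrix_vector_right_distrib iota_zero)
  also have "\<dots> = \<iota> (m * (det \<theta> - 1))"
    by (simp add: matrix_vector_mult_def sum_2 axis_nth_2 det_2 algebra_simps flip: iota_diff)
  finally show ?thesis .
qed

text \<open>The row vectors modulo \<open>p\<close> annihilated by \<theta> - I, written with least
  residues so that they can be counted as integer pairs.\<close>

definition fixed_functionals :: "(int \<times> int) set"
  where "fixed_functionals = {(c1, c2). c1 \<in> {0..<int p} \<and> c2 \<in> {0..<int p}
    \<and> int p dvd c1 * (\<theta> - mat 1) $ 1 $ 1 + c2 * (\<theta> - mat 1) $ 2 $ 1
    \<and> int p dvd c1 * (\<theta> - mat 1) $ 1 $ 2 + c2 * (\<theta> - mat 1) $ 2 $ 2}"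

lemma Fix_1_index: "add_index (flow_t.Fix 1) (flow_t.B 1) = card fixed_functionals"
proof -
  have D_in_B: "D f \<in> flow_t.B 1 \<longleftrightarrow> eval1 (D f) = 0" if "f \<in> flow_t.Z 1" for f
    unfolding ker_eval1[symmetric] using flow_t.D_in_Z[OF that] by simp
  have "eval1 ` flow_t.Fix 1 = (\<lambda>(c1, c2). (\<iota> c1, \<iota> c2)) ` fixed_functionals"
  proof (intro equalityI subsetI)
    fix a assume "a \<in> eval1 ` flow_t.Fix 1"
    then obtain f where f: "f \<in> flow_t.Z 1" "eval1 (D f) = 0" "a = eval1 f"
      using D_in_B by (auto simp: flow_t.Fix_def)
    have "eval1 f \<in> range \<iota> \<times> range \<iota>"
      using f(1) eval1_image by blast
    then obtain c1 c2 where c: "eval1 f = (\<iota> c1, \<iota> c2)" "c1 \<in> {0..<int p}" "c2 \<in> {0..<int p}"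
      unfolding range_iota by blast
    then have "(c1, c2) \<in> fixed_functionals"
      using eval1_shift[OF f(1) c(1)] f(2)
      by (simp add: fixed_functionals_def iota_eq_0 zero_prod_def)
    then show "a \<in> (\<lambda>(c1, c2). (\<iota> c1, \<iota> c2)) ` fixed_functionals"
      using c f by (auto intro!: image_eqI[of _ _ "(c1, c2)"])
  next
    fix a assume "a \<in> (\<lambda>(c1, c2). (\<iota> c1, \<iota> c2)) ` fixed_functionals"
    then obtain c1 c2 where c: "(c1, c2) \<in> fixed_functionals" "a = (\<iota> c1, \<iota> c2)"
      by auto
    have "eval1 (D (lin_cocycle c1 c2)) = 0"
      using eval1_shift[OF lin_cocycle_cocycle eval1_lin_cocycle, of c1 c2] c(1)
      by (simp add: fixed_functionals_def iota_eq_0 zero_prod_def)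
    then have "lin_cocycle c1 c2 \<in> flow_t.Fix 1"
      unfolding flow_t.Fix_def using D_in_B lin_cocycle_cocycle by blast
    then show "a \<in> eval1 ` flow_t.Fix 1"
      using c(2) eval1_lin_cocycle by (metis imageI)
  qed
  moreover have "inj_on (\<lambda>(c1, c2). (\<iota> c1, \<iota> c2)) fixed_functionals"
    using inj_on_iota by (auto simp: inj_on_def fixed_functionals_def)
  ultimately have "card fixed_functionals = card (eval1 ` flow_t.Fix 1)"
    by (simp add: card_image)
  also have "\<dots> = add_index (flow_t.Fix 1) {f \<in> flow_t.Fix 1. eval1 f \<in> {0}}"
    unfolding add_index_zero[symmetric]
  proof (rule add_index_vimage)
    show "\<exists>x\<in>flow_t.Fix 1. q - eval1 x \<in> {0}" if "q \<in> eval1 ` flow_t.Fix 1" for q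
      using that by auto
  qed (use flow_t.Fix_subgroup[of 1] in \<open>auto simp: eval1_diff add_subgroup_def\<close>)
  also have "{f \<in> flow_t.Fix 1. eval1 f \<in> {0}} = flow_t.B 1"
    using ker_eval1 flow_t.B_subset_Fix[of 1] by (auto simp: flow_t.Fix_def)
  finally show ?thesis
    by simp
qed

lemma Fix_2_index_det_1:
  assumes "det \<theta> = 1"
  shows "add_index (flow_t.Fix 2) (flow_t.B 2) = p"
proof -
  have "D f \<in> flow_t.B 2" if f: "f \<in> flow_t.Z 2" for f
  proof -
    have "eval2 f \<in> range \<iota>"
      using eval2_image f by blast
    then obtain m where "eval2 f = \<iota> m"
      by blast
    then have "eval2 (D f) = 0"
      using eval2_shift[OF f] by (simp add: assms iota_zero)
    then show ?thesis
      unfolding ker_eval2[symmetric] using flow_t.D_in_Z[OF f] by simp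
  qed
  then have "flow_t.Fix 2 = flow_t.Z 2"
    by (auto simp: flow_t.Fix_def)
  then show ?thesis
    using order_K2(3) by (simp add: cohom_order_def)
qed

text \<open>Here t acts by -1 on the classes of degree 2, so t - 1 is multiplication by -2, which is
  injective modulo an odd prime.\<close>

lemma Fix_2_index_det_minus_1:
  assumes "det \<theta> = - 1" "odd p"
  shows "add_index (flow_t.Fix 2) (flow_t.B 2) = 1"
proof -
  have "f \<in> flow_t.B 2" if "f \<in> flow_t.Fix 2" for f
  proof -
    have f: "f \<in> flow_t.Z 2" "D f \<in> flow_t.B 2"
      using that by (auto simp: flow_t.Fix_def)
    have "eval2 f \<in> range \<iota>"
      using eval2_image f(1) by blast
    then obtain m where m: "eval2 f = \<iota> m"
      by blast
    then have "int p dvd m * 2"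
      using eval2_shift[OF f(1) m] eval2_coboundary[OF f(2)] by (simp add: assms(1) iota_eq_0)
    moreover have "coprime (int p) 2"
      using assms(2) by simp
    ultimately have "int p dvd m"
      using coprime_dvd_mult_left_iff by blast
    then show ?thesis
      unfolding ker_eval2[symmetric] using f(1) m by (simp add: iota_eq_0)
  qed
  then have "flow_t.Fix 2 = flow_t.B 2"
    using flow_t.B_subset_Fix by blast
  then show ?thesis
    by (simp add: add_index_self[OF flow_t.B_subgroup])
qed

text \<open>In degree n + 1 the order is the product of the orders of the kernels of t - 1 in
  degrees n + 1 and n. These kernels are the constants in degree 0, the fixed functionals in degree
  1, and in degree 2 everything or 0 according to the determinant.\<close>

lemma order_K3:
  "cohom_order simplicial_diff (C K3) 0 = p"
  "cohom_order simplicial_diff (C K3) 1 = card fixed_functionals * p"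
  "det \<theta> = 1 \<Longrightarrow> cohom_order simplicial_diff (C K3) 2 = card fixed_functionals * p"
  "det \<theta> = - 1 \<Longrightarrow> odd p \<Longrightarrow> cohom_order simplicial_diff (C K3) 2 = card fixed_functionals"
  "det \<theta> = 1 \<Longrightarrow> cohom_order simplicial_diff (C K3) 3 = p"
  "det \<theta> = - 1 \<Longrightarrow> odd p \<Longrightarrow> cohom_order simplicial_diff (C K3) 3 = 1"
  "n \<ge> 4 \<Longrightarrow> cohom_order simplicial_diff (C K3) n = 1"
proof -
  let ?h = "cohom_order simplicial_diff (C K2)" and ?k = "\<lambda>n. add_index (flow_t.Fix n) (flow_t.B n)"
  have k: "?k 0 = p" "?k (Suc (Suc (Suc n))) = 1" for n
    using order_K2(1) flow_t.Fix_0 flow_t.Fix_eq_B_if_trivial[OF order_K2(4)]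
      add_index_self[OF flow_t.B_subgroup]
    by (simp_all add: cohom_order_def)
  have h: "?h n \<noteq> 0" for n
    using order_K2 p_pos by (cases n; cases "n - 1"; cases "n - 2") (auto simp: numeral_2_eq_2)
  have step: "cohom_order simplicial_diff (C K3) (Suc n) = ?k (Suc n) * ?k n" for n
    using flow_t.cohom_order_kernel_Suc[OF h[of n]] by (simp add: kernel_t)
  show "cohom_order simplicial_diff (C K3) 0 = p"
    using cohom_order_cochains_0[OF range_iota_subgroup] card_range_iota by simp
  show "cohom_order simplicial_diff (C K3) 1 = card fixed_functionals * p"
    using step[of 0] k(1) Fix_1_index by simp
  show "cohom_order simplicial_diff (C K3) 2 = card fixed_functionals * p" if "det \<theta> = 1"
    using step[of 1] Fix_1_index Fix_2_index_det_1[OF that] by (simp add: numeral_2_eq_2 mult.commute)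
  show "cohom_order simplicial_diff (C K3) 2 = card fixed_functionals" if "det \<theta> = - 1" "odd p"
    using step[of 1] Fix_1_index Fix_2_index_det_minus_1[OF that] by (simp add: numeral_2_eq_2)
  show "cohom_order simplicial_diff (C K3) 3 = p" if "det \<theta> = 1"
    using step[of 2] k(2)[of 0] Fix_2_index_det_1[OF that] by (simp add: numeral_2_eq_2 numeral_3_eq_3)
  show "cohom_order simplicial_diff (C K3) 3 = 1" if "det \<theta> = - 1" "odd p"
    using step[of 2] k(2)[of 0] Fix_2_index_det_minus_1[OF that] by (simp add: numeral_2_eq_2 numeral_3_eq_3)
  show "cohom_order simplicial_diff (C K3) n = 1" if "n \<ge> 4"
  proof -
    have "n = Suc (Suc (Suc (Suc (n - 4))))"
      using that by simp
    then show ?thesis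
      using step[of "Suc (Suc (Suc (n - 4)))"] k(2)[of "n - 4"] k(2)[of "Suc (n - 4)"] by simp
  qed
qed

end

section \<open>Comparison with the bar resolution\<close>

definition alt_sign :: "nat \<Rightarrow> 'a::ab_group_add \<Rightarrow> 'a"
  where "alt_sign i a = (if even i then a else - a)"

definition delete_nth :: "nat \<Rightarrow> 'x list \<Rightarrow> 'x list"
  where "delete_nth i xs = take i xs @ drop (Suc i) xs"

lemma delete_nth_Cons:
  "delete_nth 0 (x # xs) = xs" "delete_nth (Suc i) (x # xs) = x # delete_nth i xs"
  by (simp_all add: delete_nth_def)

lemma delete_nth_map: "delete_nth i (map f xs) = map f (delete_nth i xs)"
  by (simp add: delete_nth_def take_map drop_map)

lemma simplicial_diff_eq_sum:
  "simplicial_diff f xs = (\<Sum>i<length xs. alt_sign i (f (delete_nth i xs)))"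
proof (induction xs arbitrary: f)
  case (Cons x xs)
  have "(\<Sum>i<length (x # xs). alt_sign i (f (delete_nth i (x # xs))))
      = f xs + (\<Sum>i<length xs. alt_sign (Suc i) (f (x # delete_nth i xs)))"
    by (simp only: list.size(4) sum.lessThan_Suc_shift add_0_right add_Suc_right delete_nth_Cons)
      (simp add: alt_sign_def)
  also have "(\<Sum>i<length xs. alt_sign (Suc i) (f (x # delete_nth i xs)))
      = - (\<Sum>i<length xs. alt_sign i (f (x # delete_nth i xs)))"
    unfolding sum_negf[symmetric] by (intro sum.cong) (auto simp: alt_sign_def)
  finally show ?case
    by (simp add: Cons)
qed simp

fun partial_products :: "('g, 'm) monoid_scheme \<Rightarrow> 'g list \<Rightarrow> 'g list" where
  "partial_products G [] = [\<one>\<^bsub>G\<^esub>]"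
| "partial_products G (x # xs) = \<one>\<^bsub>G\<^esub> # map ((\<otimes>\<^bsub>G\<^esub>) x) (partial_products G xs)"

lemma length_partial_products: "length (partial_products G xs) = Suc (length xs)"
  by (induction xs) auto

text \<open>Homogeneous cochains on a group that fills its type, and their restriction to the chains
  1, x1, x1 x2, ..., which are the cells of the inhomogeneous bar resolution.\<close>

locale bar_comparison = cyclic_coeffs +
  fixes G :: "('g, 'm) monoid_scheme"
  assumes group_G: "group G" and carrier_G: "carrier G = UNIV"
begin

sublocale group G
  rewrites "carrier G = UNIV" and "\<And>x::'g. x \<in> UNIV \<equiv> True"
  by (rule group_G, rule carrier_G, simp)

abbreviation (input) mult_G (infixl "\<odot>" 70) where "x \<odot> y \<equiv> x \<otimes>\<^bsub>G\<^esub> y"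

definition left_mults where "left_mults = range (\<lambda>g. (\<otimes>\<^bsub>G\<^esub>) g)"

abbreviation "E \<equiv> cochains (range \<iota>) left_mults"
abbreviation "M \<equiv> integer_mod_group p"
abbreviation "pp \<equiv> partial_products G"

definition dlog :: "'a \<Rightarrow> int" where "dlog = inv_into {0..<int p} \<iota>"

lemma iota_mod: "\<iota> (x mod int p) = \<iota> x"
  by (rule sym) (simp add: iota_eq_iff)

lemma iota_minus: "\<iota> (- x) = - \<iota> x"
  using iota_diff[of 0 x] by (simp add: iota_zero)

lemma iota_dlog: "a \<in> range \<iota> \<Longrightarrow> \<iota> (dlog a) = a"
  unfolding range_iota dlog_def by (rule f_inv_into_f)

lemma dlog_in: "a \<in> range \<iota> \<Longrightarrow> dlog a \<in> {0..<int p}"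
  unfolding range_iota dlog_def by (rule inv_into_into)

lemma dlog_eqI: "x \<in> {0..<int p} \<Longrightarrow> \<iota> x = a \<Longrightarrow> dlog a = x"
  using inv_into_f_f[OF inj_on_iota] by (auto simp: dlog_def)

lemma carrier_M: "carrier M = {0..<int p}"
  using p_pos by (simp add: carrier_integer_mod_group)

lemma mod_in: "x mod int p \<in> {0..<int p}"
  using p_pos by simp

lemma dlog_add: "a \<in> range \<iota> \<Longrightarrow> b \<in> range \<iota> \<Longrightarrow> dlog (a + b) = (dlog a + dlog b) mod int p"
  by (rule dlog_eqI[OF mod_in]) (simp add: iota_mod iota_add iota_dlog)

lemma iota_pow_sign: "\<iota> (x [^]\<^bsub>M\<^esub> ((- 1) ^ k :: int)) = alt_sign k (\<iota> x)"
  by (cases "even k") (simp_all add: int_pow_integer_mod_group iota_mod alt_sign_def iota_minus)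

lemma iota_finprod:
  fixes n :: nat
  assumes "g \<in> {..<n} \<rightarrow> carrier M"
  shows "\<iota> (\<Otimes>\<^bsub>M\<^esub>i\<in>{..<n}. g i) = (\<Sum>i<n. \<iota> (g i))"
proof -
  interpret M: comm_group M
    by (rule abelian_integer_mod_group)
  show ?thesis
    using assms
  proof (induction n)
    case (Suc n)
    then have "(\<Otimes>\<^bsub>M\<^esub>i\<in>{..<Suc n}. g i) = g n \<otimes>\<^bsub>M\<^esub> (\<Otimes>\<^bsub>M\<^esub>i\<in>{..<n}. g i)"
      unfolding lessThan_Suc by (intro M.finprod_insert) auto
    moreover have "g \<in> {..<n} \<rightarrow> carrier M"
      using Suc.prems by auto
    ultimately show ?case
      using Suc.IH by (simp add: iota_mod iota_add add.commute)
  qed (simp add: iota_zero)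
qed

lemma group_tuples_G: "group_tuples G n = {xs. length xs = n}"
  by (simp add: group_tuples_def carrier_G)

lemma delete_0_pp: "delete_nth 0 (pp (x # xs)) = map ((\<otimes>\<^bsub>G\<^esub>) x) (pp xs)"
  by (simp add: delete_nth_Cons)

lemma map_mult_mult: "map ((\<otimes>\<^bsub>G\<^esub>) x) (map ((\<otimes>\<^bsub>G\<^esub>) y) xs) = map ((\<otimes>\<^bsub>G\<^esub>) (x \<odot> y)) xs"
  by (simp add: m_assoc)

text \<open>Counting from 0, vertex i + 1 of the chain 1, x1, x1 x2, ... lies between steps i and i
  + 1; removing it joins these two steps into their product.\<close>

lemma delete_Suc_pp:
  assumes "Suc i < length xs"
  shows "delete_nth (Suc i) (pp xs) = pp (merge_at G i xs)"
  using assms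
proof (induction i arbitrary: xs)
  case 0
  then obtain x y ys where "xs = x # y # ys"
    by (metis Suc_length_conv Suc_less_eq2 length_0_conv length_greater_0_conv list.exhaust not_less_eq)
  then show ?case
    using map_mult_mult by (simp add: merge_at_def delete_nth_Cons del: map_map)
next
  case (Suc i)
  then obtain x ys where xs: "xs = x # ys"
    by (cases xs) auto
  then have "merge_at G (Suc i) xs = x # merge_at G i ys"
    by (simp add: merge_at_def)
  moreover have "delete_nth (Suc i) (pp ys) = pp (merge_at G i ys)"
    using Suc xs by simp
  ultimately show ?case
    by (simp add: xs delete_nth_Cons delete_nth_map)
qed

lemma delete_last_pp:
  assumes "xs \<noteq> []"
  shows "delete_nth (length xs) (pp xs) = pp (butlast xs)"
  using assms
proof (induction xs)
  case (Cons x xs)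
  then show ?case
    by (cases "xs = []") (simp_all add: delete_nth_Cons delete_nth_map)
qed simp

lemma cochain_invariant: "f \<in> E n \<Longrightarrow> f (map ((\<otimes>\<^bsub>G\<^esub>) g) xs) = f xs"
  by (rule cochainsD(3)) (auto simp: left_mults_def)

text \<open>Inner and last faces are again chains starting at 1. The first face starts at the first
  entry of \<open>xs\<close>, and invariance moves it back to 1; this is the leading term of the bar
  differential with trivial action.\<close>

lemma simplicial_diff_pp:
  assumes f: "f \<in> E n" and xs: "length xs = Suc n"
  shows "simplicial_diff f (pp xs) = f (pp (tl xs))
    + (\<Sum>i<n. alt_sign (Suc i) (f (pp (merge_at G i xs)))) + alt_sign (Suc n) (f (pp (butlast xs)))"
proof -
  have "simplicial_diff f (pp xs) = (\<Sum>i<Suc (Suc n). alt_sign i (f (delete_nth i (pp xs))))"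
    by (simp add: simplicial_diff_eq_sum length_partial_products xs)
  also have "\<dots> = f (delete_nth 0 (pp xs)) + (\<Sum>i<n. alt_sign (Suc i) (f (delete_nth (Suc i) (pp xs))))
      + alt_sign (Suc n) (f (delete_nth (Suc n) (pp xs)))"
    by (subst sum.lessThan_Suc_shift) (simp add: alt_sign_def add.assoc)
  also have "f (delete_nth 0 (pp xs)) = f (pp (tl xs))"
  proof -
    obtain x ys where "xs = x # ys"
      using xs by (cases xs) auto
    then show ?thesis
      using cochain_invariant[OF f, of x "pp ys"] by (simp only: delete_0_pp list.sel)
  qed
  also have "(\<Sum>i<n. alt_sign (Suc i) (f (delete_nth (Suc i) (pp xs))))
      = (\<Sum>i<n. alt_sign (Suc i) (f (pp (merge_at G i xs))))"
    using xs by (intro sum.cong) (simp_all add: delete_Suc_pp)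
  also have "delete_nth (Suc n) (pp xs) = pp (butlast xs)"
    using delete_last_pp[of xs] xs by force
  finally show ?thesis .
qed

definition bar :: "nat \<Rightarrow> ('g list \<Rightarrow> 'a) \<Rightarrow> 'g list \<Rightarrow> int"
  where "bar n f = (\<lambda>xs\<in>group_tuples G n. dlog (f (pp xs)))"

abbreviation "CG n \<equiv> cochain_group G M n"

lemma carrier_CG: "carrier (CG n) = group_tuples G n \<rightarrow>\<^sub>E {0..<int p}"
  by (simp add: cochain_group_def carrier_M)

lemma comm_group_CG: "comm_group (CG n)"
proof (rule group.group_comm_groupI)
  show "group (CG n)"
    by (simp add: cochain_group_def)
  show "x \<otimes>\<^bsub>CG n\<^esub> y = y \<otimes>\<^bsub>CG n\<^esub> x" for x y
    by (simp add: cochain_group_def add.commute)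
qed

lemma bar_in: "f \<in> E n \<Longrightarrow> bar n f \<in> carrier (CG n)"
  unfolding carrier_CG using dlog_in cochainsD(1) by (fastforce simp: bar_def)

lemma bar_add:
  assumes "f \<in> E n" "g \<in> E n"
  shows "bar n (f + g) = bar n f \<otimes>\<^bsub>CG n\<^esub> bar n g"
  using dlog_add[OF cochainsD(1)[OF assms(1)] cochainsD(1)[OF assms(2)]]
  by (simp add: bar_def cochain_group_def fun_eq_iff)

text \<open>Inverse to \<open>partial_products\<close> up to left multiplication by the first
  entry.\<close>

fun ratios :: "'g list \<Rightarrow> 'g list" where
  "ratios (x # y # xs) = (inv\<^bsub>G\<^esub> x \<odot> y) # ratios (y # xs)"
| "ratios _ = []"

lemma length_ratios: "length (ratios xs) = length xs - 1"
  by (induction xs rule: ratios.induct) simp_all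

lemma ratios_map: "ratios (map ((\<otimes>\<^bsub>G\<^esub>) g) xs) = ratios xs"
proof (induction xs rule: ratios.induct)
  case (1 x y xs)
  have "inv\<^bsub>G\<^esub> (g \<odot> x) \<odot> (g \<odot> y) = inv\<^bsub>G\<^esub> x \<odot> y"
    by (simp add: inv_mult_group m_assoc) (simp flip: m_assoc)
  with 1 show ?case
    by simp
qed simp_all

lemma ratios_pp: "ratios (pp xs) = xs"
proof (induction xs)
  case (Cons x xs)
  obtain ys where ys: "pp xs = \<one>\<^bsub>G\<^esub> # ys"
    by (cases xs) auto
  have "ratios (pp (x # xs)) = x # ratios (map ((\<otimes>\<^bsub>G\<^esub>) x) (pp xs))"
    by (simp add: ys)
  then show ?case
    by (simp add: ratios_map Cons)
qed simp

lemma map_pp_ratios: "map ((\<otimes>\<^bsub>G\<^esub>) x) (pp (ratios (x # xs))) = x # xs"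
proof (induction xs arbitrary: x)
  case (Cons y xs)
  have "x \<odot> (inv\<^bsub>G\<^esub> x \<odot> y) = y"
    by (simp flip: m_assoc)
  then show ?case
    using Cons[of y] map_mult_mult[of x "inv\<^bsub>G\<^esub> x \<odot> y"] by (simp del: map_map)
qed simp

lemma cochain_eq_pp_ratios:
  assumes "f \<in> E n" "xs \<noteq> []"
  shows "f xs = f (pp (ratios xs))"
  using assms(2) cochain_invariant[OF assms(1), of "hd xs" "pp (ratios xs)"] map_pp_ratios[of "hd xs" "tl xs"]
  by simp

lemma inj_on_bar: "inj_on (bar n) (E n)"
proof (rule inj_onI, rule ext)
  fix f g xs assume fg: "f \<in> E n" "g \<in> E n" "bar n f = bar n g"
  show "f xs = g xs"
  proof (cases "length xs = Suc n")
    case True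
    then have "ratios xs \<in> group_tuples G n" and "xs \<noteq> []"
      by (auto simp: group_tuples_G length_ratios)
    from this(1) have "dlog (f (pp (ratios xs))) = dlog (g (pp (ratios xs)))"
      using fun_cong[OF fg(3), of "ratios xs"] by (simp add: bar_def)
    then have "f (pp (ratios xs)) = g (pp (ratios xs))"
      using iota_dlog[OF cochainsD(1)[OF fg(1)]] iota_dlog[OF cochainsD(1)[OF fg(2)]] by metis
    then show ?thesis
      unfolding cochain_eq_pp_ratios[OF fg(1) \<open>xs \<noteq> []\<close>] cochain_eq_pp_ratios[OF fg(2) \<open>xs \<noteq> []\<close>] .
  qed (simp add: cochainsD(2)[OF fg(1)] cochainsD(2)[OF fg(2)])
qed

lemma bar_image: "bar n ` E n = carrier (CG n)"
proof (intro equalityI subsetI)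
  fix c assume c: "c \<in> carrier (CG n)"
  \<comment> \<open>Since left multiplication does not change ratios, \<open>c\<close> applied to
    them extends to an invariant cochain.\<close>
  define f where "f = (\<lambda>xs. if length xs = Suc n then \<iota> (c (ratios xs)) else 0)"
  have "f \<in> E n"
    by (rule cochainsI)
      (auto simp: f_def left_mults_def ratios_map add_subgroup_zero[OF range_iota_subgroup])
  moreover have "bar n f = c"
  proof
    fix xs
    show "bar n f xs = c xs"
    proof (cases "xs \<in> group_tuples G n")
      case True
      then have "c xs \<in> {0..<int p}"
        using c unfolding carrier_CG by blast
      with True show ?thesis
        by (auto simp: bar_def f_def ratios_pp length_partial_products group_tuples_G intro: dlog_eqI)
    next
      case False
      then show ?thesis
        using c unfolding carrier_CG by (auto simp: bar_def PiE_def extensional_def)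
    qed
  qed
  ultimately show "c \<in> bar n ` E n"
    by blast
qed (auto simp: bar_in)

lemma coboundary_map_bar:
  assumes f: "f \<in> E n"
  shows "coboundary_map G M (\<lambda>_ m. m) n (bar n f) = bar (Suc n) (simplicial_diff f)"
proof
  fix xs
  show "coboundary_map G M (\<lambda>_ m. m) n (bar n f) xs = bar (Suc n) (simplicial_diff f) xs"
  proof (cases "length xs = Suc n")
    case True
    have bar_nth: "bar n f ys = dlog (f (pp ys))" if "length ys = n" for ys
      using that by (simp add: bar_def group_tuples_G)
    have iota_bar: "\<iota> (bar n f ys) = f (pp ys)" if "length ys = n" for ys
      using that iota_dlog[OF cochainsD(1)[OF f]] by (simp add: bar_nth)
    have len: "length (tl xs) = n" "length (butlast xs) = n" "\<And>i. i < n \<Longrightarrow> length (merge_at G i xs) = n"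
      using True by (auto simp: merge_at_def)
    define X where "X = coboundary_map G M (\<lambda>_ m. m) n (bar n f) xs"
    have X: "X = bar n f (tl xs)
       \<otimes>\<^bsub>M\<^esub> (\<Otimes>\<^bsub>M\<^esub>i\<in>{..<n}. bar n f (merge_at G i xs) [^]\<^bsub>M\<^esub> ((- 1) ^ Suc i :: int))
       \<otimes>\<^bsub>M\<^esub> bar n f (butlast xs) [^]\<^bsub>M\<^esub> ((- 1) ^ Suc n :: int)"
      using True by (simp add: X_def coboundary_map_def group_tuples_G del: power_Suc)
    \<comment> \<open>The identity is verified after applying \<iota>, which turns products in
      \<open>M\<close> into sums; as \<open>X\<close> is a least residue, \<open>dlog\<close>
      recovers it.\<close>
    have "\<iota> X = simplicial_diff f (pp xs)"
    proof -
      have "(\<lambda>i. bar n f (merge_at G i xs) [^]\<^bsub>M\<^esub> ((- 1) ^ Suc i :: int)) \<in> {..<n} \<rightarrow> carrier M"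
        unfolding carrier_M using p_pos by (auto simp: int_pow_integer_mod_group simp del: power_Suc)
      then show ?thesis
        unfolding X simplicial_diff_pp[OF f True]
        using len by (simp add: iota_mod iota_add iota_finprod iota_pow_sign iota_bar del: power_Suc)
    qed
    moreover have "X \<in> {0..<int p}"
      unfolding X using p_pos by simp
    ultimately show ?thesis
      using True dlog_eqI[of X "simplicial_diff f (pp xs)"] by (simp add: X_def bar_def group_tuples_G)
  qed (simp add: coboundary_map_def bar_def group_tuples_G)
qed

sublocale E: add_complex E simplicial_diff
  by (rule add_complex_cochains[OF range_iota_subgroup])

lemma bar_zero: "bar n 0 = \<one>\<^bsub>CG n\<^esub>"
  using dlog_eqI[OF _ iota_zero] p_pos by (simp add: bar_def cochain_group_def fun_eq_iff)

section \<open>Exponent and order of the cohomology groups\<close>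

lemma cocycles_bar: "cocycles G M (\<lambda>_ m. m) n = bar n ` E.Z n"
proof -
  have "bar (Suc n) (simplicial_diff f) = \<one>\<^bsub>CG (Suc n)\<^esub> \<longleftrightarrow> simplicial_diff f = 0" if "f \<in> E n" for f
    using inj_on_eq_iff[OF inj_on_bar E.d_in[OF that] add_subgroup_zero[OF E.E_subgroup]]
    by (simp add: bar_zero)
  then show ?thesis
    unfolding cocycles_def kernel_def bar_image[symmetric]
    by (auto simp: cx_cocycles_def coboundary_map_bar bar_zero)
qed

lemma coboundaries_bar: "coboundaries G M (\<lambda>_ m. m) n = bar n ` E.B n"
proof (cases n)
  case (Suc m)
  show ?thesis
    unfolding Suc coboundaries_def cx_coboundaries_def
    by (simp add: bar_image[symmetric] image_image coboundary_map_bar cong: image_cong)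
qed (simp add: coboundaries_def cx_coboundaries_def bar_zero)

lemma subgroup_bar:
  assumes S: "add_subgroup S" "S \<subseteq> E n"
  shows "subgroup (bar n ` S) (CG n)"
proof -
  interpret CG: comm_group "CG n"
    by (rule comm_group_CG)
  show ?thesis
  proof (rule CG.subgroupI)
    show "bar n ` S \<subseteq> carrier (CG n)"
      using S bar_in by blast
    show "bar n ` S \<noteq> {}"
      using add_subgroup_zero[OF S(1)] by blast
  next
    fix a assume "a \<in> bar n ` S"
    then obtain f where f: "a = bar n f" "f \<in> S"
      by blast
    then have "- f \<in> S"
      by (simp add: add_subgroup_uminus[OF S(1)])
    then have "bar n (- f) \<otimes>\<^bsub>CG n\<^esub> a = \<one>\<^bsub>CG n\<^esub>"
      using f S bar_add[of "- f" n f] by (simp add: bar_zero subset_iff)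
    then have "inv\<^bsub>CG n\<^esub> a = bar n (- f)"
      using f \<open>- f \<in> S\<close> S bar_in by (intro CG.inv_equality) auto
    then show "inv\<^bsub>CG n\<^esub> a \<in> bar n ` S"
      using \<open>- f \<in> S\<close> by blast
  next
    fix a b assume "a \<in> bar n ` S" "b \<in> bar n ` S"
    then obtain f g where fg: "a = bar n f" "b = bar n g" "f \<in> S" "g \<in> S"
      by blast
    then have "a \<otimes>\<^bsub>CG n\<^esub> b = bar n (f + g)"
      using S bar_add[of f n g] by (simp add: subset_iff)
    then show "a \<otimes>\<^bsub>CG n\<^esub> b \<in> bar n ` S"
      using fg add_subgroup_add[OF S(1)] by blast
  qed
qed

abbreviation "H n \<equiv> trivial_coeff_cohomology G M n"
abbreviation "ZG n \<equiv> (CG n)\<lparr>carrier := bar n ` E.Z n\<rparr>"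

lemma H_eq: "H n = ZG n Mod (bar n ` E.B n)"
  by (simp add: trivial_coeff_cohomology_def group_cohomology_def cocycles_bar coboundaries_bar)

lemma Z_subset_E: "E.Z n \<subseteq> E n"
  by (auto simp: cx_cocycles_def)

lemma comm_group_ZG: "comm_group (ZG n)"
proof (rule group.group_comm_groupI)
  interpret CG: comm_group "CG n"
    by (rule comm_group_CG)
  show "group (ZG n)"
    using subgroup_bar[OF E.Z_subgroup Z_subset_E] by (rule subgroup.subgroup_is_group) (rule CG.is_group)
  show "x \<otimes>\<^bsub>ZG n\<^esub> y = y \<otimes>\<^bsub>ZG n\<^esub> x" if "x \<in> carrier (ZG n)" "y \<in> carrier (ZG n)" for x y
    using that subgroup.subset[OF subgroup_bar[OF E.Z_subgroup Z_subset_E]] by (auto intro: CG.m_comm)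
qed

lemma normal_B: "(bar n ` E.B n) \<lhd> ZG n"
proof -
  have "subgroup (bar n ` E.B n) (CG n)"
    using E.B_subset_Z Z_subset_E by (intro subgroup_bar E.B_subgroup) blast
  then have "subgroup (bar n ` E.B n) (ZG n)"
    using E.B_subset_Z comm_group_CG subgroup_bar[OF E.Z_subgroup Z_subset_E]
    by (intro group.subgroup_incl) (auto simp: comm_group_def)
  then show ?thesis
    using comm_group.subgroup_imp_normal[OF comm_group_ZG] by blast
qed

lemma comm_group_H: "comm_group (H n)"
  unfolding H_eq using comm_group.abelian_FactGroup[OF comm_group_ZG] normal_B normal_imp_subgroup by blast

lemma pow_CG: "c \<in> carrier (CG n) \<Longrightarrow> c [^]\<^bsub>CG n\<^esub> (k::nat) = (\<lambda>xs\<in>group_tuples G n. (int k * c xs) mod int p)"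
proof (induction k)
  case 0
  then show ?case
    by (simp add: cochain_group_def)
next
  case (Suc k)
  then show ?case
    by (simp add: cochain_group_def fun_eq_iff mod_simps algebra_simps)
qed

text \<open>The exponent is inherited from the cochains, whose values lie in a group of exponent
  \<open>p\<close>.\<close>

lemma exponent_H:
  assumes "x \<in> carrier (H n)"
  shows "x [^]\<^bsub>H n\<^esub> p = \<one>\<^bsub>H n\<^esub>"
proof -
  interpret N: normal "bar n ` E.B n" "ZG n"
    by (rule normal_B)
  obtain a where a: "a \<in> bar n ` E.Z n" "x = bar n ` E.B n #>\<^bsub>ZG n\<^esub> a"
    using assms by (auto simp: H_eq carrier_FactGroup)
  have "a \<in> carrier (CG n)"
    using a(1) Z_subset_E bar_in by blast
  then have "a [^]\<^bsub>CG n\<^esub> p = \<one>\<^bsub>CG n\<^esub>"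
    by (simp add: pow_CG) (simp add: cochain_group_def)
  then have "a [^]\<^bsub>ZG n\<^esub> p = \<one>\<^bsub>ZG n\<^esub>"
    by (simp add: nat_pow_def)
  then show ?thesis
    using a N.FactGroup_pow[of a p] N.coset_mult_one[OF N.subset] by (simp add: H_eq)
qed

text \<open>On cochains \<open>bar\<close> is injective and additive, so it carries cosets of
  homogeneous coboundaries bijectively to cosets of inhomogeneous ones.\<close>

lemma card_H: "card (carrier (H n)) = cohom_order simplicial_diff E n"
proof -
  have coset: "bar n ` E.B n #>\<^bsub>ZG n\<^esub> bar n z = bar n ` add_coset (E.B n) z" if z: "z \<in> E.Z n" for z
  proof -
    have B: "b \<in> E n" if "b \<in> E.B n" for b
      using that E.B_subset_Z Z_subset_E by blast
    have "add_coset (E.B n) z = (\<lambda>b. b + z) ` E.B n"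
    proof (intro equalityI subsetI)
      fix y assume "y \<in> add_coset (E.B n) z"
      then have "y - z \<in> E.B n" "y = (y - z) + z"
        by (simp_all add: add_coset_def)
      then show "y \<in> (\<lambda>b. b + z) ` E.B n"
        by blast
    qed (auto simp: add_coset_def)
    then have "bar n ` add_coset (E.B n) z = (\<lambda>b. bar n b \<otimes>\<^bsub>CG n\<^esub> bar n z) ` E.B n"
      using subsetD[OF Z_subset_E z] B by (auto simp: image_image bar_add intro!: image_cong)
    then show ?thesis
      by (auto simp: r_coset_def)
  qed
  have sub: "add_coset (E.B n) z \<subseteq> E n" if z: "z \<in> E.Z n" for z
  proof
    fix y assume "y \<in> add_coset (E.B n) z"
    then have "y - z \<in> E.Z n"
      using E.B_subset_Z by (auto simp: add_coset_def)
    then have "(y - z) + z \<in> E.Z n"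
      using z add_subgroup_add[OF E.Z_subgroup] by blast
    then show "y \<in> E n"
      using Z_subset_E by auto
  qed
  have "carrier (H n) = (\<lambda>X. bar n ` X) ` (add_coset (E.B n) ` E.Z n)"
  proof -
    have "carrier (H n) = (\<lambda>a. bar n ` E.B n #>\<^bsub>ZG n\<^esub> a) ` (bar n ` E.Z n)"
      unfolding H_eq carrier_FactGroup by simp
    also have "\<dots> = (\<lambda>z. bar n ` add_coset (E.B n) z) ` E.Z n"
      unfolding image_image by (rule image_cong[OF refl coset])
    finally show ?thesis
      by (simp add: image_image)
  qed
  moreover have "inj_on (\<lambda>X. bar n ` X) (add_coset (E.B n) ` E.Z n)"
    using inj_on_image_eq_iff[OF inj_on_bar] sub by (auto simp: inj_on_def)
  ultimately show ?thesis
    by (simp add: card_image cohom_order_def add_index_def)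
qed

end

section \<open>Abelian groups of prime exponent\<close>

lemma card_Zp_power:
  assumes "p > 0"
  shows "card (carrier (Zp_power p d)) = p ^ d"
  using assms by (simp add: Zp_power_def carrier_integer_mod_group card_PiE)

lemma group_Zp_power: "group (Zp_power p d)"
  by (simp add: Zp_power_def)

lemma (in group) int_pow_mod_exponent:
  assumes "x \<in> carrier G" "x [^] p = \<one>"
  shows "x [^] (m mod int p) = x [^] m"
proof -
  have "x [^] m = x [^] (int p * (m div int p) + m mod int p)"
    by simp
  also have "\<dots> = (x [^] int p) [^] (m div int p) \<otimes> x [^] (m mod int p)"
    using assms(1) by (simp only: int_pow_mult int_pow_pow)
  also have "\<dots> = x [^] (m mod int p)"
    using assms by (simp add: int_pow_int)
  finally show ?thesis
    by simp
qed

text \<open>A finite abelian group of prime exponent is built up from cyclic factors: as long as an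
  embedded power of the cyclic group is not everything, any element outside adds another factor.\<close>

lemma (in comm_group) Zp_power_embeds:
  assumes p: "Factorial_Ring.prime p" and exp: "\<And>x. x \<in> carrier G \<Longrightarrow> x [^] p = \<one>"
    and card: "card (carrier G) = p ^ d" and "k \<le> d"
  shows "\<exists>\<phi>\<in>hom (Zp_power p k) G. inj_on \<phi> (carrier (Zp_power p k))"
  using \<open>k \<le> d\<close>
proof (induction k)
  case 0
  have "(\<lambda>_. \<one>) \<in> hom (Zp_power p 0) G"
    by (rule homI) auto
  moreover have "inj_on (\<lambda>_. \<one>) (carrier (Zp_power p 0))"
    by (simp add: Zp_power_def)
  ultimately show ?case
    by blast
next
  case (Suc k)
  then obtain \<phi> where \<phi>: "\<phi> \<in> hom (Zp_power p k) G" "inj_on \<phi> (carrier (Zp_power p k))"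
    by auto
  have p_pos: "p > 0"
    using p prime_gt_0_nat by blast
  interpret \<phi>: group_hom "Zp_power p k" G \<phi>
    by (rule group_hom.intro) (use \<phi> in \<open>auto simp: group_Zp_power group_hom_axioms_def\<close>)
  define I where "I = \<phi> ` carrier (Zp_power p k)"
  have I: "subgroup I G"
    unfolding I_def by (rule \<phi>.img_is_subgroup)
  have "card I = p ^ k"
    using \<phi>(2) p_pos by (simp add: I_def card_image card_Zp_power)
  also have "\<dots> < card (carrier G)"
    using Suc.prems prime_gt_1_nat[OF p] by (simp add: card)
  finally have "I \<noteq> carrier G"
    by auto
  then obtain x where x: "x \<in> carrier G" "x \<notin> I"
    using subgroup.subset[OF I] by blast
  \<comment> \<open>If \<open>p\<close> does not divide \<open>m\<close>, then \<open>m\<close> is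
    invertible modulo \<open>p\<close>, so \<open>x\<close> is a power of \<open>x [^] m\<close> and
    would lie in \<open>I\<close>.\<close>
  have x_pow: "int p dvd m" if "x [^] m \<in> I" for m :: int
  proof (rule ccontr)
    assume "\<not> int p dvd m"
    then have "coprime m (int p)"
      using p prime_imp_coprime[of "int p" m] by (simp add: coprime_commute)
    then obtain u v where uv: "m * u + int p * v = 1"
      using bezout_int[of m "int p"] by (metis coprime_imp_gcd_eq_1 mult.commute)
    have "x [^] (m * u + int p * v) = (x [^] m) [^] u \<otimes> (x [^] int p) [^] v"
      using x(1) by (simp only: int_pow_mult int_pow_pow)
    also have "\<dots> = (x [^] m) [^] u"
      using x(1) exp[OF x(1)] by (simp add: int_pow_int)
    finally have "x = (x [^] m) [^] u"
      using x(1) by (simp add: uv)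
    also have "\<dots> \<in> I"
      by (rule subgroup_int_pow_closed[OF I that])
    finally show False
      using x(2) by simp
  qed
  \<comment> \<open>The new coordinate goes to powers of \<open>x\<close>; this respects addition
    modulo \<open>p\<close> because \<open>x\<close> has exponent \<open>p\<close>.\<close>
  define \<psi> where "\<psi> = (\<lambda>c. \<phi> (restrict c {..<k}) \<otimes> x [^] (c k :: int))"
  have restr: "restrict c {..<k} \<in> carrier (Zp_power p k)" if "c \<in> carrier (Zp_power p (Suc k))" for c
    using that by (auto simp: Zp_power_def PiE_def)
  have "\<psi> \<in> hom (Zp_power p (Suc k)) G"
  proof (rule homI)
    fix a assume "a \<in> carrier (Zp_power p (Suc k))"
    then show "\<psi> a \<in> carrier G"
      using restr x(1) by (simp add: \<psi>_def)
  next
    fix a b assume ab: "a \<in> carrier (Zp_power p (Suc k))" "b \<in> carrier (Zp_power p (Suc k))"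
    have "restrict (a \<otimes>\<^bsub>Zp_power p (Suc k)\<^esub> b) {..<k}
        = restrict a {..<k} \<otimes>\<^bsub>Zp_power p k\<^esub> restrict b {..<k}"
      by (auto simp: Zp_power_def fun_eq_iff)
    moreover have "(a \<otimes>\<^bsub>Zp_power p (Suc k)\<^esub> b) k = (a k + b k) mod int p"
      by (simp add: Zp_power_def)
    moreover have "x [^] ((a k + b k) mod int p) = x [^] a k \<otimes> x [^] b k"
      using x(1) exp[OF x(1)] by (simp add: int_pow_mod_exponent int_pow_mult)
    ultimately show "\<psi> (a \<otimes>\<^bsub>Zp_power p (Suc k)\<^esub> b) = \<psi> a \<otimes> \<psi> b"
      using restr[OF ab(1)] restr[OF ab(2)] x(1) by (simp add: \<psi>_def m_ac)
  qed
  moreover have "inj_on \<psi> (carrier (Zp_power p (Suc k)))"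
  proof (rule inj_onI)
    fix a b assume ab: "a \<in> carrier (Zp_power p (Suc k))" "b \<in> carrier (Zp_power p (Suc k))" "\<psi> a = \<psi> b"
    let ?a = "\<phi> (restrict a {..<k})" and ?b = "\<phi> (restrict b {..<k})"
    have mem: "?a \<in> I" "?b \<in> I"
      using restr ab by (auto simp: I_def)
    then have carr: "?a \<in> carrier G" "?b \<in> carrier G"
      using subgroup.subset[OF I] by auto
    \<comment> \<open>Solving \<open>\<psi> a = \<psi> b\<close> for the power of \<open>x\<close>
      places it in \<open>I\<close>, and \<open>x_pow\<close> then forces equal last
      coordinates.\<close>
    have "x [^] (a k - b k) = inv ?a \<otimes> (?a \<otimes> x [^] a k) \<otimes> inv (x [^] b k)"
      using carr x(1) by (simp add: int_pow_diff flip: m_assoc)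
    also have "?a \<otimes> x [^] a k = ?b \<otimes> x [^] b k"
      using ab(3) by (simp add: \<psi>_def)
    also have "inv ?a \<otimes> (?b \<otimes> x [^] b k) \<otimes> inv (x [^] b k) = inv ?a \<otimes> ?b"
      using carr x(1) by (simp add: m_assoc)
    also have "\<dots> \<in> I"
      using mem subgroup.m_closed[OF I] subgroup.m_inv_closed[OF I] by blast
    finally have "int p dvd a k - b k"
      by (rule x_pow)
    moreover have "a k \<in> {0..<int p}" "b k \<in> {0..<int p}"
      using ab p_pos by (auto simp: Zp_power_def PiE_iff carrier_integer_mod_group)
    ultimately have k: "a k = b k"
      by (simp flip: mod_eq_dvd_iff)
    then have "?a = ?b"
      using ab(3) carr x(1) by (simp add: \<psi>_def)
    then have restr_eq: "restrict a {..<k} = restrict b {..<k}"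
      using \<phi>(2) restr ab by (simp add: inj_on_eq_iff)
    show "a = b"
    proof
      fix i
      consider "i < k" | "i = k" | "i > k"
        by linarith
      then show "a i = b i"
      proof cases
        case 1
        then show ?thesis
          using fun_cong[OF restr_eq, of i] by simp
      next
        case 3
        then show ?thesis
          using ab by (simp add: Zp_power_def PiE_def extensional_def)
      qed (use k in simp)
    qed
  qed
  ultimately show ?case
    by blast
qed

lemma (in comm_group) iso_Zp_power:
  assumes "Factorial_Ring.prime p" "\<And>x. x \<in> carrier G \<Longrightarrow> x [^] p = \<one>" "card (carrier G) = p ^ d"
  shows "G \<cong> Zp_power p d"
proof -
  obtain \<phi> where \<phi>: "\<phi> \<in> hom (Zp_power p d) G" "inj_on \<phi> (carrier (Zp_power p d))"
    using Zp_power_embeds[OF assms order_refl] by blast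
  have p_pos: "p > 0"
    using assms(1) prime_gt_0_nat by blast
  then have "finite (carrier G)"
    using assms(3) by (simp add: card_ge_0_finite)
  moreover have "\<phi> ` carrier (Zp_power p d) \<subseteq> carrier G"
    using \<phi>(1) by (auto simp: hom_def)
  moreover have "card (\<phi> ` carrier (Zp_power p d)) = card (carrier G)"
    using \<phi>(2) p_pos by (simp add: card_image card_Zp_power assms(3))
  ultimately have "\<phi> ` carrier (Zp_power p d) = carrier G"
    by (simp add: card_subset_eq)
  then have "\<phi> \<in> iso (Zp_power p d) G"
    using \<phi> by (simp add: iso_def bij_betw_def)
  then show ?thesis
    using group.iso_sym[OF group_Zp_power] is_isoI by blast
qed

text \<open>Both groups are isomorphic to \<open>Zp_power p 1\<close>, since the cyclic group
  satisfies the same assumptions.\<close>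

lemma (in comm_group) iso_integer_mod_group:
  assumes "Factorial_Ring.prime p" "\<And>x. x \<in> carrier G \<Longrightarrow> x [^] p = \<one>" "card (carrier G) = p"
  shows "G \<cong> integer_mod_group p"
proof -
  have p_pos: "p > 0"
    using assms(1) prime_gt_0_nat by blast
  have "integer_mod_group p \<cong> Zp_power p 1"
    using p_pos by (intro comm_group.iso_Zp_power) (auto simp: assms(1) carrier_integer_mod_group)
  moreover have "G \<cong> Zp_power p 1"
    using assms by (intro iso_Zp_power) auto
  ultimately show ?thesis
    using iso_trans group.iso_sym[OF group_integer_mod_group] by blast
qed

lemma (in group) trivial_group_if_card_1: "card (carrier G) = 1 \<Longrightarrow> trivial_group G"
  by (auto simp: trivial_group card_1_singleton_iff)

section \<open>Rank modulo a prime\<close>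

text \<open>Linear independence passes to the span regarded as a space of its own, where
  \<open>T\<close> becomes a basis.\<close>

lemma (in vectorspace) dim_span_lin_indpt:
  assumes "finite T" "T \<subseteq> carrier V" "lin_indpt T"
  shows "vectorspace.dim K (V\<lparr>carrier := span T\<rparr>) = card T"
proof -
  have sub: "subspace K (span T) V"
    by (rule span_is_subspace[OF assms(2)])
  interpret W: vectorspace K "V\<lparr>carrier := span T\<rparr>"
    by (rule subspace_is_vs[OF sub])
  have subm: "submodule K (span T) V"
    by (rule span_is_submodule[OF assms(2)])
  have own: "T \<subseteq> span T"
    by (rule in_own_span[OF assms(2)])
  have "W.basis T"
    unfolding W.basis_def
    using span_li_not_depend[OF own subm] assms(3) own by simp
  then show ?thesis
    by (rule W.dim_basis[OF assms(1)])
qed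

lemma (in vectorspace) span_singleton:
  assumes "v \<in> carrier V"
  shows "span {v} = (\<lambda>a. a \<odot>\<^bsub>V\<^esub> v) ` carrier K"
proof -
  have *: "lincomb a {v} = a v \<odot>\<^bsub>V\<^esub> v" if "a v \<in> carrier K" for a
    using that assms by (simp add: lincomb_def)
  have span: "span {v} = {lincomb a {v} |a. a \<in> {v} \<rightarrow> carrier K}"
    using assms by (intro finite_span) auto
  show ?thesis
  proof (intro equalityI subsetI)
    fix w assume "w \<in> span {v}"
    then show "w \<in> (\<lambda>a. a \<odot>\<^bsub>V\<^esub> v) ` carrier K"
      unfolding span using * by auto
  next
    fix w assume "w \<in> (\<lambda>a. a \<odot>\<^bsub>V\<^esub> v) ` carrier K"
    then obtain a where a: "a \<in> carrier K" "w = a \<odot>\<^bsub>V\<^esub> v"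
      by blast
    then have "w = lincomb (\<lambda>_. a) {v}"
      using *[of "\<lambda>_. a"] by simp
    with a(1) show "w \<in> span {v}"
      unfolding span by blast
  qed
qed

lemma (in vectorspace) lin_indpt_singleton:
  assumes "v \<in> carrier V" "v \<noteq> \<zero>\<^bsub>V\<^esub>"
  shows "lin_indpt {v}"
  using lin_dep_iff_in_span[of "{}" v] assms by (simp add: span_empty finite_lin_indpt2)

section \<open>Rank and left kernel of a 2 x 2 matrix modulo a prime\<close>

definition mat_zero_mod :: "nat \<Rightarrow> int ^ 2 ^ 2 \<Rightarrow> bool"
  where "mat_zero_mod p A \<longleftrightarrow> (\<forall>i j. int p dvd A $ i $ j)"

lemma ex_inverse_mod_prime:
  assumes "Factorial_Ring.prime p" "\<not> int p dvd x"
  obtains z where "int p dvd x * z - 1"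
proof -
  have "coprime x (int p)"
    using assms prime_imp_coprime[of "int p" x] by (simp add: coprime_commute)
  then obtain z where "[x * z = 1] (mod int p)"
    using cong_solve_coprime_int by blast
  then show thesis
    using that by (simp add: cong_iff_dvd_diff)
qed

text \<open>The factor \<open>l\<close> is b/a or d/c modulo \<open>p\<close>, whichever denominator
  is invertible; the vanishing determinant makes it work for the other row too.\<close>

lemma proportional_mod_prime:
  assumes "Factorial_Ring.prime p" "int p dvd a * d - b * c" "\<not> (int p dvd a \<and> int p dvd c)"
  obtains l where "int p dvd b - l * a" "int p dvd d - l * c"
proof (cases "int p dvd a")
  case False
  then obtain z where z: "int p dvd a * z - 1"
    using ex_inverse_mod_prime[OF assms(1)] by blast
  have "b - b * z * a = - b * (a * z - 1)" "d - b * z * c = - d * (a * z - 1) + z * (a * d - b * c)"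
    by (simp_all add: algebra_simps)
  then show thesis
    using z assms(2) by (intro that[of "b * z"]) (simp_all only: dvd_add dvd_mult)
next
  case True
  then obtain z where z: "int p dvd c * z - 1"
    using ex_inverse_mod_prime[OF assms(1)] assms(3) by blast
  have "b - d * z * a = - b * (c * z - 1) - z * (a * d - b * c)" "d - d * z * c = - d * (c * z - 1)"
    by (simp_all add: algebra_simps)
  then show thesis
    using z assms(2) by (intro that[of "d * z"]) (simp_all only: dvd_diff dvd_mult)
qed

lemma mat_zero_mod_imp_det: "mat_zero_mod p A \<Longrightarrow> int p dvd det A"
  by (simp add: mat_zero_mod_def det_2)

text \<open>Turns the dimension of a span into divisibility conditions, the form in which left
  kernels are counted below.\<close>

lemma rank_mod_2:
  fixes A :: "int ^ 2 ^ 2"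
  assumes p: "Factorial_Ring.prime p"
  shows "rank_mod p A = (if mat_zero_mod p A then 0 else if int p dvd det A then 1 else 2)"
proof -
  define K where "K = residue_ring (int p)"
  interpret R: residues_prime p K
    by unfold_locales (simp_all add: p K_def)
  define V where "V = ring.func_space K (UNIV :: 2 set)"
  interpret V: vectorspace K V
    unfolding vectorspace_def using R.func_space_is_module[of "UNIV :: 2 set"] R.is_field by (simp add: V_def Module.module_def)
  let ?c = "column_mod p A"
  have p1: "int p > 1"
    using prime_gt_1_nat[OF p] by simp
  have K: "carrier K = {0..<int p}" "\<zero>\<^bsub>K\<^esub> = 0"
    "x \<otimes>\<^bsub>K\<^esub> y = x * y mod int p" for x y
    by (auto simp: K_def residue_ring_def)
  have V: "carrier V = UNIV \<rightarrow>\<^sub>E {0..<int p}" "\<zero>\<^bsub>V\<^esub> = (\<lambda>_. 0)"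
    "l \<odot>\<^bsub>V\<^esub> f = (\<lambda>i. l * f i mod int p)" for l f
    by (simp_all add: V_def R.func_space_def K restrict_def)
  have c: "?c j \<in> carrier V" for j
    using p1 by (simp add: V column_mod_def PiE_UNIV_domain)
  have range_c: "range ?c = {?c 1, ?c 2}"
    unfolding UNIV_2 by simp
  have rank: "rank_mod p A = vectorspace.dim K (V\<lparr>carrier := V.span {?c 1, ?c 2}\<rparr>)"
    by (simp add: rank_mod_def range_c K_def V_def Let_def)
  have c_zero: "?c j = \<zero>\<^bsub>V\<^esub> \<longleftrightarrow> (\<forall>i. int p dvd A $ i $ j)" for j
    by (auto simp: V column_mod_def fun_eq_iff)
  \<comment> \<open>The scalar may be any integer, since reducing it modulo \<open>p\<close> does
    not change the multiple; \<open>proportional_mod_prime\<close> supplies such an integer.\<close>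
  have in_span: "?c j \<in> V.span {?c i} \<longleftrightarrow> (\<exists>l. \<forall>k. int p dvd A $ k $ j - l * A $ k $ i)" for i j
  proof -
    have "?c j \<in> V.span {?c i} \<longleftrightarrow> (\<exists>l\<in>{0..<int p}. \<forall>k. A $ k $ j mod int p = l * A $ k $ i mod int p)"
      using V.span_singleton[OF c] by (simp add: image_iff K V column_mod_def fun_eq_iff mod_simps)
    also have "\<dots> \<longleftrightarrow> (\<exists>l. \<forall>k. A $ k $ j mod int p = l * A $ k $ i mod int p)"
    proof
      assume "\<exists>l. \<forall>k. A $ k $ j mod int p = l * A $ k $ i mod int p"
      then obtain l where "\<forall>k. A $ k $ j mod int p = l * A $ k $ i mod int p"
        by blast
      then have "\<forall>k. A $ k $ j mod int p = (l mod int p) * A $ k $ i mod int p"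
        by (simp add: mod_simps)
      moreover have "l mod int p \<in> {0..<int p}"
        using p1 by simp
      ultimately show "\<exists>l\<in>{0..<int p}. \<forall>k. A $ k $ j mod int p = l * A $ k $ i mod int p"
        by blast
    qed blast
    finally show ?thesis
      by (simp add: mod_eq_dvd_iff)
  qed
  \<comment> \<open>Stated for arbitrary \<open>i\<close> and \<open>j\<close> so that either column
    can serve as the spanning one.\<close>
  have dim1: "rank_mod p A = 1" if "?c i \<noteq> \<zero>\<^bsub>V\<^esub>" "?c j \<in> V.span {?c i}" "{?c 1, ?c 2} = {?c i, ?c j}" for i j
  proof -
    have "V.span {?c i, ?c j} = V.span {?c i}"
      using V.already_in_span[of "{?c i}" "?c j"] c that(2) by (simp add: insert_commute)
    then show ?thesis
      using V.dim_span_lin_indpt[of "{?c i}"] V.lin_indpt_singleton[OF c that(1)] c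
      by (simp add: rank that(3))
  qed
  have det: "det A = A $ 1 $ 1 * A $ 2 $ 2 - A $ 1 $ 2 * A $ 2 $ 1"
    by (rule det_2)
  consider (zero) "mat_zero_mod p A" | (one) "\<not> mat_zero_mod p A" "int p dvd det A" | (two) "\<not> int p dvd det A"
    by blast
  then show ?thesis
  proof cases
    case zero
    then have "{?c 1, ?c 2} = {\<zero>\<^bsub>V\<^esub>}"
      using c_zero by (simp add: mat_zero_mod_def)
    moreover have "V.span {\<zero>\<^bsub>V\<^esub>} = V.span {}"
      using V.already_in_span[of "{}" "\<zero>\<^bsub>V\<^esub>"] V.span_zero by simp
    ultimately have "rank_mod p A = 0"
      using V.dim_span_lin_indpt[of "{}"] V.finite_lin_indpt2[of "{}"] by (simp add: rank)
    with zero show ?thesis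
      by simp
  next
    case one
    have "rank_mod p A = 1"
    proof (cases "?c 1 = \<zero>\<^bsub>V\<^esub>")
      case False
      then have "\<not> (int p dvd A $ 1 $ 1 \<and> int p dvd A $ 2 $ 1)"
        by (simp add: c_zero forall_2)
      then obtain l where "int p dvd A $ 1 $ 2 - l * A $ 1 $ 1" "int p dvd A $ 2 $ 2 - l * A $ 2 $ 1"
        using proportional_mod_prime[OF p] one(2) det by metis
      then have "?c 2 \<in> V.span {?c 1}"
        unfolding in_span forall_2 by blast
      then show ?thesis
        using dim1 False by blast
    next
      case True
      then have "?c 2 \<noteq> \<zero>\<^bsub>V\<^esub>"
        using one(1) unfolding mat_zero_mod_def c_zero forall_2 by blast
      moreover have "?c 1 \<in> V.span {?c 2}"
        using True V.span_zero by simp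
      ultimately show ?thesis
        using dim1[of 2 1] by (simp add: insert_commute)
    qed
    with one show ?thesis
      by simp
  next
    case two
    have "?c 1 \<noteq> \<zero>\<^bsub>V\<^esub>"
    proof
      assume "?c 1 = \<zero>\<^bsub>V\<^esub>"
      then have "int p dvd A $ 1 $ 1" "int p dvd A $ 2 $ 1"
        by (simp_all add: c_zero)
      then show False
        using two by (simp add: det)
    qed
    moreover have notin: "?c 2 \<notin> V.span {?c 1}"
    proof
      assume "?c 2 \<in> V.span {?c 1}"
      then obtain l where l: "int p dvd A $ 1 $ 2 - l * A $ 1 $ 1" "int p dvd A $ 2 $ 2 - l * A $ 2 $ 1"
        unfolding in_span by blast
      have "det A = A $ 1 $ 1 * (A $ 2 $ 2 - l * A $ 2 $ 1) - A $ 2 $ 1 * (A $ 1 $ 2 - l * A $ 1 $ 1)"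
        unfolding det by (simp add: algebra_simps)
      then show False
        using two l by simp
    qed
    moreover have "?c 2 \<noteq> ?c 1"
      using notin V.span_self[OF c] by metis
    ultimately have "V.lin_indpt {?c 1, ?c 2}"
      using V.lin_dep_iff_in_span[of "{?c 1}" "?c 2"] V.lin_indpt_singleton[OF c] c by (simp add: insert_commute)
    then have "rank_mod p A = card {?c 1, ?c 2}"
      unfolding rank using V.dim_span_lin_indpt[of "{?c 1, ?c 2}"] c by simp
    with two \<open>?c 2 \<noteq> ?c 1\<close> show ?thesis
      using mat_zero_mod_imp_det[of p A] by auto
  qed
qed

text \<open>As \<open>x\<close> is invertible modulo \<open>p\<close>, the solutions form the graph
  of c1 as a function of c2.\<close>

lemma card_line_mod_prime:
  assumes p: "Factorial_Ring.prime p" and "\<not> int p dvd x"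
  shows "card {(c1, c2). c1 \<in> {0..<int p} \<and> c2 \<in> {0..<int p} \<and> int p dvd c1 * x + c2 * y} = p"
proof -
  have p_pos: "p > 0"
    using p prime_gt_0_nat by blast
  obtain z where z: "int p dvd x * z - 1"
    using ex_inverse_mod_prime[OF assms] by blast
  define f where "f = (\<lambda>c2. ((- c2 * y * z) mod int p, c2))"
  have iff: "int p dvd c1 * x + c2 * y \<longleftrightarrow> c1 = (- c2 * y * z) mod int p" if "c1 \<in> {0..<int p}" for c1 c2
  proof -
    have "int p dvd c1 * x + c2 * y \<longleftrightarrow> int p dvd c1 - (- c2 * y * z)"
    proof
      assume "int p dvd c1 * x + c2 * y"
      moreover have "c1 - (- c2 * y * z) = z * (c1 * x + c2 * y) - c1 * (x * z - 1)"
        by (simp add: algebra_simps)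
      ultimately show "int p dvd c1 - (- c2 * y * z)"
        using z by simp
    next
      assume "int p dvd c1 - (- c2 * y * z)"
      moreover have "c1 * x + c2 * y = x * (c1 - (- c2 * y * z)) - c2 * y * (x * z - 1)"
        by (simp add: algebra_simps)
      ultimately show "int p dvd c1 * x + c2 * y"
        using z by simp
    qed
    also have "\<dots> \<longleftrightarrow> c1 mod int p = (- c2 * y * z) mod int p"
      by (simp only: mod_eq_dvd_iff)
    finally show ?thesis
      using that by simp
  qed
  have "{(c1, c2). c1 \<in> {0..<int p} \<and> c2 \<in> {0..<int p} \<and> int p dvd c1 * x + c2 * y} = f ` {0..<int p}"
    using p_pos by (auto simp: f_def iff)
  moreover have "inj_on f {0..<int p}"
    by (auto simp: inj_on_def f_def)
  ultimately show ?thesis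
    by (simp add: card_image)
qed

lemma card_line_mod_prime':
  assumes p: "Factorial_Ring.prime p" and "\<not> (int p dvd x \<and> int p dvd y)"
  shows "card {(c1, c2). c1 \<in> {0..<int p} \<and> c2 \<in> {0..<int p} \<and> int p dvd c1 * x + c2 * y} = p"
proof (cases "int p dvd x")
  case True
  then have y: "\<not> int p dvd y"
    using assms(2) by blast
  have "{(c1, c2). c1 \<in> {0..<int p} \<and> c2 \<in> {0..<int p} \<and> int p dvd c1 * x + c2 * y}
      = prod.swap ` {(c1, c2). c1 \<in> {0..<int p} \<and> c2 \<in> {0..<int p} \<and> int p dvd c1 * y + c2 * x}"
    by (auto simp: add.commute image_iff)
  then show ?thesis
    using card_line_mod_prime[OF p y, of x] by (simp add: card_image)
qed (rule card_line_mod_prime[OF p])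

text \<open>With A = \<theta> - I this counts \<open>fixed_functionals\<close>; the cases are those
  of \<open>rank_mod_2\<close>.\<close>

lemma card_left_kernel_mod:
  fixes A :: "int ^ 2 ^ 2"
  assumes p: "Factorial_Ring.prime p"
  shows "card {(c1, c2). c1 \<in> {0..<int p} \<and> c2 \<in> {0..<int p}
      \<and> int p dvd c1 * A $ 1 $ 1 + c2 * A $ 2 $ 1 \<and> int p dvd c1 * A $ 1 $ 2 + c2 * A $ 2 $ 2}
    = p ^ (2 - rank_mod p A)" (is "card ?S = _")
proof -
  have p_pos: "p > 0"
    using p prime_gt_0_nat by blast
  have det: "det A = A $ 1 $ 1 * A $ 2 $ 2 - A $ 1 $ 2 * A $ 2 $ 1"
    by (rule det_2)
  consider (zero) "mat_zero_mod p A" | (one) "\<not> mat_zero_mod p A" "int p dvd det A" | (two) "\<not> int p dvd det A"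
    by blast
  then show ?thesis
  proof cases
    case zero
    then have "?S = {0..<int p} \<times> {0..<int p}"
      by (auto simp: mat_zero_mod_def)
    with zero show ?thesis
      by (simp add: rank_mod_2[OF p] card_cartesian_product power2_eq_square)
  next
    case one
    define a b c d where abcd: "a = A $ 1 $ 1" "b = A $ 1 $ 2" "c = A $ 2 $ 1" "d = A $ 2 $ 2"
    have dvd: "int p dvd a * d - b * c"
      using one(2) by (simp add: det abcd)
    have "card ?S = p"
    proof (cases "int p dvd a \<and> int p dvd c")
      case True
      then have "\<not> (int p dvd b \<and> int p dvd d)"
        using one(1) by (simp add: mat_zero_mod_def forall_2 abcd)
      moreover have "?S = {(c1, c2). c1 \<in> {0..<int p} \<and> c2 \<in> {0..<int p} \<and> int p dvd c1 * b + c2 * d}"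
        using True by (auto simp: abcd)
      ultimately show ?thesis
        using card_line_mod_prime'[OF p] by simp
    next
      case False
      then obtain l where l: "int p dvd b - l * a" "int p dvd d - l * c"
        using proportional_mod_prime[OF p dvd] by blast
      \<comment> \<open>The second column is \<open>l\<close> times the first modulo
        \<open>p\<close>, so the second congruence follows from the first.\<close>
      have "int p dvd c1 * b + c2 * d" if "int p dvd c1 * a + c2 * c" for c1 c2
      proof -
        have "c1 * b + c2 * d = l * (c1 * a + c2 * c) + c1 * (b - l * a) + c2 * (d - l * c)"
          by (simp add: algebra_simps)
        then show ?thesis
          using that l by simp
      qed
      then have "?S = {(c1, c2). c1 \<in> {0..<int p} \<and> c2 \<in> {0..<int p} \<and> int p dvd c1 * a + c2 * c}"
        by (auto simp: abcd)
      then show ?thesis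
        using card_line_mod_prime'[OF p False] by simp
    qed
    with one show ?thesis
      by (simp add: rank_mod_2[OF p])
  next
    case two
    define a b c d where abcd: "a = A $ 1 $ 1" "b = A $ 1 $ 2" "c = A $ 2 $ 1" "d = A $ 2 $ 2"
    have "c1 = 0 \<and> c2 = 0" if c: "(c1, c2) \<in> ?S" for c1 c2
    proof -
      have dvd: "int p dvd c1 * a + c2 * c" "int p dvd c1 * b + c2 * d"
        using c by (simp_all add: abcd)
      \<comment> \<open>Cramer's rule: combining the two congruences with the entries of the
        adjugate isolates each unknown.\<close>
      have "c1 * det A = d * (c1 * a + c2 * c) - c * (c1 * b + c2 * d)"
        "c2 * det A = a * (c1 * b + c2 * d) - b * (c1 * a + c2 * c)"
        unfolding det abcd[symmetric] by (simp_all add: algebra_simps)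
      then have "int p dvd c1 * det A" "int p dvd c2 * det A"
        using dvd by simp_all
      then have "int p dvd c1" "int p dvd c2"
        using two p by (simp_all add: prime_dvd_mult_iff)
      with c show ?thesis
        by (auto dest: zdvd_imp_le)
    qed
    then have "?S = {(0, 0)}"
      using p_pos by auto
    moreover have "\<not> mat_zero_mod p A"
      using two mat_zero_mod_imp_det by blast
    ultimately show ?thesis
      using two by (simp add: rank_mod_2[OF p])
  qed
qed

section \<open>Coefficients and the group structure\<close>

\<comment> \<open>Q/Z contains a cyclic group of every finite order, so one type, independent of
  \<open>p\<close>, carries the coefficients.\<close>
quotient_type rat_mod_int = rat / "\<lambda>x y. x - y \<in> \<int>"
proof (rule equivpI)
  show "symp (\<lambda>x y :: rat. x - y \<in> \<int>)"
    proof (rule sympI)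
    fix x y :: rat assume "x - y \<in> \<int>"
    then have "- (x - y) \<in> \<int>"
      by (rule Ints_minus)
    then show "y - x \<in> \<int>"
      by simp
  qed
  show "transp (\<lambda>x y :: rat. x - y \<in> \<int>)"
  proof (rule transpI)
    fix x y z :: rat assume "x - y \<in> \<int>" "y - z \<in> \<int>"
    then have "(x - y) + (y - z) \<in> \<int>"
      by (rule Ints_add)
    then show "x - z \<in> \<int>"
      by simp
  qed
qed (simp add: reflp_def)

instantiation rat_mod_int :: ab_group_add
begin

lift_definition zero_rat_mod_int :: rat_mod_int is 0 .

lift_definition plus_rat_mod_int :: "rat_mod_int \<Rightarrow> rat_mod_int \<Rightarrow> rat_mod_int" is "(+)"
  by (simp only: add_diff_add Ints_add)

lift_definition minus_rat_mod_int :: "rat_mod_int \<Rightarrow> rat_mod_int \<Rightarrow> rat_mod_int" is "(-)"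
proof -
  fix x y x' y' :: rat assume "x - y \<in> \<int>" "x' - y' \<in> \<int>"
  then have "(x - y) - (x' - y') \<in> \<int>"
    by (rule Ints_diff)
  then show "(x - x') - (y - y') \<in> \<int>"
    by (simp add: algebra_simps)
qed

lift_definition uminus_rat_mod_int :: "rat_mod_int \<Rightarrow> rat_mod_int" is uminus
proof -
  fix x y :: rat assume "x - y \<in> \<int>"
  then have "- (x - y) \<in> \<int>"
    by (rule Ints_minus)
  then show "- x - - y \<in> \<int>"
    by simp
qed

instance
  by standard (transfer; simp)+

end

lift_definition frac_mod_int :: "nat \<Rightarrow> int \<Rightarrow> rat_mod_int" is "\<lambda>p x. of_int x / of_nat p" .

lemma cyclic_coeffs_frac_mod_int:
  assumes p: "Factorial_Ring.prime p"
  shows "cyclic_coeffs (frac_mod_int p) p"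
proof
  show "frac_mod_int p (x + y) = frac_mod_int p x + frac_mod_int p y" for x y
    by transfer (simp add: add_divide_distrib)
  show "frac_mod_int p x = 0 \<longleftrightarrow> int p dvd x" for x
  proof -
    have "p > 0"
      using p prime_gt_0_nat by blast
    have "(of_int x / of_nat p :: rat) \<in> \<int> \<longleftrightarrow> int p dvd x"
    proof
      assume "(of_int x / of_nat p :: rat) \<in> \<int>"
      then obtain k where "(of_int x / of_nat p :: rat) = of_int k"
        by (auto elim: Ints_cases)
      then have "(of_int x :: rat) = of_int (k * int p)"
        using \<open>p > 0\<close> by (simp add: field_simps)
      then have "x = k * int p"
        by (simp only: of_int_eq_iff)
      then show "int p dvd x"
        by simp
    next
      assume "int p dvd x"
      then obtain k where "x = int p * k"
        by blast
      then show "(of_int x / of_nat p :: rat) \<in> \<int>"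
        using \<open>p > 0\<close> by simp
    qed
    then show ?thesis
      by transfer simp
  qed
qed (rule p)

section \<open>Powers of \<theta> and the torus bundle group\<close>

definition monodromy :: "int ^ 2 ^ 2 \<Rightarrow> int \<Rightarrow> int ^ 2 \<Rightarrow> int ^ 2"
  where "monodromy \<theta> k = ((*v) \<theta>) [^]\<^bsub>AutoGroup int_plane\<^esub> k"

lemma group_int_plane: "group int_plane"
  by (rule groupI) (auto simp: int_plane_def add.assoc intro: exI[of _ "- x" for x])

text \<open>These are the axioms of \<open>torus_cochains\<close>. Invertibility places \<theta> in
  the automorphism group, where negative powers make sense.\<close>

lemma monodromy_properties:
  assumes "invertible \<theta>"
  shows "monodromy \<theta> 0 v = v" "monodromy \<theta> (i + j) v = monodromy \<theta> i (monodromy \<theta> j v)"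
    "monodromy \<theta> 1 v = \<theta> *v v" "monodromy \<theta> i (u + v) = monodromy \<theta> i u + monodromy \<theta> i v"
proof -
  interpret A: group "AutoGroup int_plane"
    by (rule group.AutoGroup[OF group_int_plane])
  have carr: "carrier (AutoGroup int_plane) = {f. (\<forall>u v. f (u + v) = f u + f v) \<and> bij f}"
    by (auto simp: AutoGroup_def auto_def hom_def int_plane_def Bij_def)
  \<comment> \<open>Multiplication in \<open>AutoGroup\<close> is composition restricted to the
    carrier, which here is the whole type.\<close>
  have mult: "f \<otimes>\<^bsub>AutoGroup int_plane\<^esub> g = f \<circ> g"
    if "f \<in> carrier (AutoGroup int_plane)" "g \<in> carrier (AutoGroup int_plane)" for f g
    using that unfolding carr
    by (auto simp: AutoGroup_def BijGroup_def int_plane_def Bij_def compose_def fun_eq_iff)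
  obtain B where B: "\<theta> ** B = mat 1" "B ** \<theta> = mat 1"
    using assms by (auto simp: invertible_def)
  have "bij ((*v) \<theta>)"
    by (rule o_bij[where g = "(*v) B"]) (simp_all add: fun_eq_iff matrix_vector_mul_assoc B)
  then have \<theta>: "(*v) \<theta> \<in> carrier (AutoGroup int_plane)"
    by (simp add: carr matrix_vector_right_distrib)
  have M: "monodromy \<theta> k \<in> carrier (AutoGroup int_plane)" for k
    unfolding monodromy_def using \<theta> by (rule A.int_pow_closed)
  show "monodromy \<theta> 0 v = v"
    by (simp add: monodromy_def AutoGroup_def BijGroup_def int_plane_def)
  show "monodromy \<theta> (i + j) v = monodromy \<theta> i (monodromy \<theta> j v)"
    using mult[OF M M] A.int_pow_mult[OF \<theta>] by (metis comp_apply monodromy_def)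
  show "monodromy \<theta> 1 v = \<theta> *v v"
    using \<theta> by (simp add: monodromy_def A.int_pow_1)
  show "monodromy \<theta> i (u + v) = monodromy \<theta> i u + monodromy \<theta> i v"
    using M[of i] by (simp add: carr)
qed

lemma torus_bundle_group_simps:
  "carrier (torus_bundle_group \<theta>) = UNIV"
  "(u, i) \<otimes>\<^bsub>torus_bundle_group \<theta>\<^esub> (v, j) = (u + monodromy \<theta> i v, i + j)"
  "\<one>\<^bsub>torus_bundle_group \<theta>\<^esub> = (0, 0)"
  by (simp_all add: torus_bundle_group_def semidirect_product_def int_plane_def integer_group_def
      monodromy_def)

lemma group_torus_bundle_group:
  assumes "invertible \<theta>"
  shows "group (torus_bundle_group \<theta>)"
proof -
  note M = monodromy_properties[OF assms]
  have M_zero: "monodromy \<theta> i 0 = 0" for i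
    using M(4)[of i 0 0] by simp
  show ?thesis
  proof (rule groupI)
    fix x y z
    show "x \<otimes>\<^bsub>torus_bundle_group \<theta>\<^esub> y \<otimes>\<^bsub>torus_bundle_group \<theta>\<^esub> z
        = x \<otimes>\<^bsub>torus_bundle_group \<theta>\<^esub> (y \<otimes>\<^bsub>torus_bundle_group \<theta>\<^esub> z)"
      by (cases x; cases y; cases z) (simp add: torus_bundle_group_simps M add.assoc)
    show "\<one>\<^bsub>torus_bundle_group \<theta>\<^esub> \<otimes>\<^bsub>torus_bundle_group \<theta>\<^esub> x = x"
      by (cases x) (simp add: torus_bundle_group_simps M)
    obtain u i where x: "x = (u, i)"
      by fastforce
    have "(monodromy \<theta> (- i) (- u), - i) \<otimes>\<^bsub>torus_bundle_group \<theta>\<^esub> x = \<one>\<^bsub>torus_bundle_group \<theta>\<^esub>"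
      by (simp add: x torus_bundle_group_simps M_zero flip: M(4))
    then show "\<exists>y\<in>carrier (torus_bundle_group \<theta>). y \<otimes>\<^bsub>torus_bundle_group \<theta>\<^esub> x = \<one>\<^bsub>torus_bundle_group \<theta>\<^esub>"
      unfolding torus_bundle_group_simps(1) by blast
  qed (simp_all add: torus_bundle_group_simps)
qed

section \<open>The cohomology groups\<close>

theorem theorem5:
  fixes \<theta> :: "int ^ 2 ^ 2" and p :: nat
  assumes "invertible \<theta>" and "Factorial_Ring.prime p" and "odd p"
  shows "let H = trivial_coeff_cohomology (torus_bundle_group \<theta>) (integer_mod_group p);
             r = rank_mod p (\<theta> - mat 1)
         in H 0 \<cong> integer_mod_group p
          \<and> H 1 \<cong> Zp_power p (3 - r)
          \<and> (det \<theta> = 1 \<longrightarrow> H 2 \<cong> Zp_power p (3 - r))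
          \<and> (det \<theta> = - 1 \<longrightarrow> H 2 \<cong> Zp_power p (2 - r))
          \<and> (det \<theta> = 1 \<longrightarrow> H 3 \<cong> integer_mod_group p)
          \<and> (det \<theta> = - 1 \<longrightarrow> trivial_group (H 3))
          \<and> (\<forall>n\<ge>4. trivial_group (H n))"
proof -
  interpret T: torus_cochains "frac_mod_int p" p \<theta> "monodromy \<theta>"
    using cyclic_coeffs_frac_mod_int[OF assms(2)] monodromy_properties[OF assms(1)]
    by (simp add: torus_cochains_def torus_cochains_axioms_def)
  interpret G: bar_comparison "frac_mod_int p" p "torus_bundle_group \<theta>"
    using cyclic_coeffs_frac_mod_int[OF assms(2)] group_torus_bundle_group[OF assms(1)]
    by (simp add: bar_comparison_def bar_comparison_axioms_def torus_bundle_group_simps(1))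
  define r where "r = rank_mod p (\<theta> - mat 1)"
  \<comment> \<open>Exponents use truncated subtraction; the bound ensures that an extra factor
    \<open>p\<close> raises the exponent 2 - r to 3 - r.\<close>
  have "r \<le> 2"
    by (simp add: r_def rank_mod_2[OF assms(2)])
  then have r: "p ^ (2 - r) * p = p ^ (3 - r)"
    by (simp flip: power_Suc2 add: Suc_diff_le[symmetric])
  \<comment> \<open>Left multiplication by \<open>(u, j)\<close> is \<open>flow_t j\<close> followed
    by a translation, so the cochains whose cohomology was counted are those compared with the bar
    resolution.\<close>
  have "G.left_mults = T.K3"
    unfolding G.left_mults_def T.K3_def
    by (intro image_cong) (auto simp: fun_eq_iff torus_bundle_group_simps translation_def T.flow_t_def)
  then have card: "card (carrier (G.H n)) = cohom_order simplicial_diff (T.C T.K3) n" for n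
    by (simp add: G.card_H)
  have fixed: "card T.fixed_functionals = p ^ (2 - r)"
    unfolding T.fixed_functionals_def r_def by (rule card_left_kernel_mod[OF assms(2)])
  interpret H: comm_group "G.H n" for n
    by (rule G.comm_group_H)
  note iso = H.iso_Zp_power[OF assms(2) G.exponent_H] H.iso_integer_mod_group[OF assms(2) G.exponent_H]
    H.trivial_group_if_card_1
  note orders = T.order_K3 card fixed r
  have "G.H 0 \<cong> integer_mod_group p"
    by (rule iso) (simp_all add: orders)
  moreover have "G.H 1 \<cong> Zp_power p (3 - r)"
    by (rule iso) (simp_all add: orders[unfolded One_nat_def])
  moreover have "det \<theta> = 1 \<longrightarrow> G.H 2 \<cong> Zp_power p (3 - r)"
    by (intro impI iso) (simp_all add: orders)
  moreover have "det \<theta> = - 1 \<longrightarrow> G.H 2 \<cong> Zp_power p (2 - r)"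
    by (intro impI iso) (simp_all add: orders assms(3))
  moreover have "det \<theta> = 1 \<longrightarrow> G.H 3 \<cong> integer_mod_group p"
    by (intro impI iso) (simp_all add: orders)
  moreover have "det \<theta> = - 1 \<longrightarrow> trivial_group (G.H 3)"
    by (intro impI iso) (simp_all add: orders assms(3))
  moreover have "\<forall>n\<ge>4. trivial_group (G.H n)"
    by (intro allI impI iso) (simp add: orders)
  ultimately show ?thesis
    unfolding Let_def r_def by blast
qed

end
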